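(* Every generalized Lie algebroid $\left((F,\nu,N),[\,,]_{F,h},(\rho,\eta)\right)$ is a (distinguished) example of a Lie algebroid.
   Context: All bases of vector bundles are paracompact. $\mathcal{F}(N)$ is the ring of smooth real functions on a manifold $N$, $\Gamma(F,\nu,N)$ is the $\mathcal{F}(N)$-module of sections of a vector bundle $(F,\nu,N)$, and $\mathrm{Der}(\mathcal{F})$ is the $\mathcal{F}$-module of derivations of a commutative unitary ring $\mathcal{F}$, with the commutator bracket. Sections of $(TN,\tau_N,N)$ act on $\mathcal{F}(N)$ as derivations. Generalized Lie algebra. A generalized Lie algebra over a commutative unitary ring $\mathcal{F}$ is a triple $(A,[\,,]_A,\rho)$ where $A$ is an $\mathcal{F}$-module, $(A,[\,,]_A)$ is a Lie prealgebra over $\mathcal{F}$ (that is, $[\,,]_A$ is a biadditive operation on $A$, not necessarily $\mathcal{F}$-bilinear, with $[u,u]_A=0$ and $[u,[v,z]_A]_A+[z,[u,v]_A]_A+[v,[z,u]_A]_A=0$ for all $u,v,z\in A$), and $\rho:A\to\mathrm{Der}(\mathcal{F})$ is a morphism of $\mathcal{F}$-modules (the anchor map) with $[u,f\cdot v]_A=f\cdot[u,v]_A+\rho(u)(f)\cdot v$ for all $u,v\in A$, $f\in\mathcal{F}$. Generalized Lie algebroid. A triple $\left((F,\nu,N),[\,,]_{F,h},(\rho,\eta)\right)$, where $(F,\nu,N)$ is a vector bundle, $\eta:N\to M$ and $h:M\to N$ are arbitrary diffeomorphisms, $(\rho,\eta)$ is a vector bundle morphism from $(F,\nu,N)$ to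 $(TM,\tau_M,M)$, i.e. $\rho:F\to TM$ covers $\eta$, and $[\,,]_{F,h}$ is an operation on $\Gamma(F,\nu,N)$ such that the triple $\left(\Gamma(F,\nu,N),[\,,]_{F,h},\Gamma(Th\circ\rho,h\circ\eta)\right)$ is a generalized Lie algebra over $\mathcal{F}(N)$, where the anchor map, denoted $\Gamma(Th\circ\rho,h\circ\eta)$, is given by $$\left(\Gamma(Th\circ\rho,h\circ\eta)(u^{\alpha}t_{\alpha})\right)(f)=u^{\alpha}\rho_{\alpha}^{i}\cdot\left(\frac{\partial(f\circ h)}{\partial x^{i}}\circ h^{-1}\right)$$ for all $u^{\alpha}t_{\alpha}\in\Gamma(F,\nu,N)$ and $f\in\mathcal{F}(N)$. Here $(t_\alpha)$ is a local base of sections of $F$, $(x^i)$ are local coordinates on $M$, and $\rho_\alpha^i$ are the component functions on $N$ of the morphism $(\rho,\eta)$, so that the induced map on sections is $\Gamma(\rho,\eta)(z^\alpha t_\alpha)=\left((z^\alpha\rho_\alpha^i)\circ\eta^{-1}\right)\frac{\partial}{\partial x^i}$. Lie algebroid. A triple $\left((F,\nu,N),[\,,]_F,(\theta,\mathrm{Id}_N)\right)$, where $(F,\nu,N)$ is a vector bundle, $[\,,]_F$ is an operation on $\Gamma(F,\nu,N)$, and $(\theta,\mathrm{Id}_N)$ is a vector bundle morphism from $(F,\nu,N)$ to $(TN,\tau_N,N)$, such that $\left((\Gamma(F,\nu,N),[\,,]_F),(\mathcal{F}(N),\cdot),\Gamma(\theta,\mathrm{Id}_N)\right)$ is a Lie-Rinehart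 algebra over $\mathbb{R}$: $(\Gamma(F,\nu,N),[\,,]_F)$ is a Lie algebra over $\mathbb{R}$, and the induced $\mathcal{F}(N)$-module morphism $\Gamma(\theta,\mathrm{Id}_N):\Gamma(F,\nu,N)\to\mathrm{Der}(\mathcal{F}(N))$ preserves brackets and satisfies $[u,f\cdot v]_F=f\cdot[u,v]_F+\Gamma(\theta,\mathrm{Id}_N)(u)(f)\cdot v$ for all $u,v\in\Gamma(F,\nu,N)$, $f\in\mathcal{F}(N)$. *)

theory Defs
  imports
    "HOL-Analysis.Analysis"
    "HOL-Algebra.Module"
begin

section \<open>Smooth manifolds\<close>

text \<open>
  Model spaces are finite-dimensional real inner product spaces. The class
  \<^class>\<open>real_inner\<close> is used with an explicit finite orthonormal basis, because
  \<^class>\<open>euclidean_space\<close> excludes dimension 0, and hence (generalized) Lie algebroids over a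
  point, i.e. Lie algebras.
\<close>

definition orthonormal_list :: "'e::real_inner list \<Rightarrow> bool" where
  "orthonormal_list bs \<longleftrightarrow>
     (\<forall>i<length bs. \<forall>j<length bs. bs ! i \<bullet> bs ! j = (if i = j then 1 else 0)) \<and>
     span (set bs) = UNIV"

fun Ck_on :: "nat \<Rightarrow> 'a::real_normed_vector set \<Rightarrow> ('a \<Rightarrow> 'b::real_normed_vector) \<Rightarrow> bool" where
  "Ck_on 0 S f \<longleftrightarrow> continuous_on S f"
| "Ck_on (Suc k) S f \<longleftrightarrow>
     (\<forall>x\<in>S. f differentiable (at x)) \<and> (\<forall>v. Ck_on k S (\<lambda>x. frechet_derivative f (at x) v))"

text \<open>Only used for open \<open>S\<close> in a finite-dimensional space.\<close>

definition smooth_on :: "'a::real_normed_vector set \<Rightarrow> ('a \<Rightarrow> 'b::real_normed_vector) \<Rightarrow> bool" where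
  "smooth_on S f \<longleftrightarrow> (\<forall>k. Ck_on k S f)"

definition paracompact_space :: "'a topology \<Rightarrow> bool" where
  "paracompact_space X \<longleftrightarrow>
     (\<forall>\<U>. (\<forall>U\<in>\<U>. openin X U) \<and> \<Union>\<U> = topspace X \<longrightarrow>
        (\<exists>\<V>. (\<forall>V\<in>\<V>. openin X V \<and> (\<exists>U\<in>\<U>. V \<subseteq> U)) \<and> \<Union>\<V> = topspace X \<and>
             locally_finite_in X \<V>))"

text \<open>A chart is a pair of a domain and a coordinate map, whose values off the domain are irrelevant.\<close>

type_synonym ('m, 'e) chart = "'m set \<times> ('m \<Rightarrow> 'e)"

definition is_chart :: "'m topology \<Rightarrow> ('m, 'e::real_inner) chart \<Rightarrow> bool" where
  "is_chart X c \<longleftrightarrow> openin X (fst c) \<and> open (snd c ` fst c) \<and>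
     homeomorphic_map (subtopology X (fst c)) (top_of_set (snd c ` fst c)) (snd c)"

definition chart_inv :: "('m, 'e) chart \<Rightarrow> 'e \<Rightarrow> 'm" where
  "chart_inv c = inv_into (fst c) (snd c)"

definition compatible_charts :: "('m, 'e::real_inner) chart \<Rightarrow> ('m, 'e) chart \<Rightarrow> bool" where
  "compatible_charts c d \<longleftrightarrow>
     smooth_on (snd c ` (fst c \<inter> fst d)) (snd d \<circ> chart_inv c) \<and>
     smooth_on (snd d ` (fst c \<inter> fst d)) (snd c \<circ> chart_inv d)"

record ('m, 'e) manifold =
  mtop :: "'m topology"
  charts :: "('m, 'e) chart set"

abbreviation points :: "('m, 'e) manifold \<Rightarrow> 'm set" where
  "points M \<equiv> topspace (mtop M)"

text \<open>The field \<^const>\<open>charts\<close> is the maximal atlas.\<close>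

definition smooth_manifold :: "('m, 'e::real_inner) manifold \<Rightarrow> bool" where
  "smooth_manifold M \<longleftrightarrow>
     Hausdorff_space (mtop M) \<and> paracompact_space (mtop M) \<and>
     (\<exists>bs :: 'e list. orthonormal_list bs) \<and>
     (\<forall>c\<in>charts M. is_chart (mtop M) c) \<and>
     (\<forall>c\<in>charts M. \<forall>d\<in>charts M. compatible_charts c d) \<and>
     (\<Union>c\<in>charts M. fst c) = points M \<and>
     (\<forall>c. is_chart (mtop M) c \<and> (\<forall>d\<in>charts M. compatible_charts c d) \<longrightarrow> c \<in> charts M)"

definition smooth_fun_on :: "('m, 'e::real_inner) manifold \<Rightarrow> 'm set \<Rightarrow> ('m \<Rightarrow> real) \<Rightarrow> bool" where
  "smooth_fun_on M U f \<longleftrightarrow>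
     (\<forall>c\<in>charts M. smooth_on (snd c ` (fst c \<inter> U)) (f \<circ> chart_inv c))"

definition smooth_map ::
  "('m, 'e::real_inner) manifold \<Rightarrow> ('n, 'd::real_inner) manifold \<Rightarrow> ('m \<Rightarrow> 'n) \<Rightarrow> bool" where
  "smooth_map M N h \<longleftrightarrow> continuous_map (mtop M) (mtop N) h \<and>
     (\<forall>c\<in>charts M. \<forall>d\<in>charts N.
        smooth_on (snd c ` (fst c \<inter> h -` fst d)) (snd d \<circ> h \<circ> chart_inv c))"

definition diffeomorphism ::
  "('m, 'e::real_inner) manifold \<Rightarrow> ('n, 'd::real_inner) manifold \<Rightarrow> ('m \<Rightarrow> 'n) \<Rightarrow> bool" where
  "diffeomorphism M N h \<longleftrightarrow> bij_betw h (points M) (points N) \<and>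
     smooth_map M N h \<and> smooth_map N M (inv_into (points M) h)"

text \<open>
  The ring \<open>\<F>(M)\<close>. Functions on \<open>M\<close> are represented by extensional functions (value
  \<^const>\<open>undefined\<close> off \<^term>\<open>points M\<close>).
\<close>

definition smooth_functions :: "('m, 'e::real_inner) manifold \<Rightarrow> ('m \<Rightarrow> real) ring" where
  "smooth_functions M =
     \<lparr>carrier = {f \<in> extensional (points M). smooth_fun_on M (points M) f},
      monoid.mult = (\<lambda>f g. \<lambda>x\<in>points M. f x * g x),
      one = (\<lambda>x\<in>points M. 1),
      ring.zero = (\<lambda>x\<in>points M. 0),
      add = (\<lambda>f g. \<lambda>x\<in>points M. f x + g x)\<rparr>"


section \<open>Vector bundles\<close>

text \<open>
  A local frame \<open>(k, U, t)\<close> stands for the vector bundle chart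
  \<open>U \<times> \<real>\<^sup>k \<rightarrow> \<nu>\<^sup>-\<^sup>1(U), (x, a) \<mapsto> \<Sum>\<alpha><k. a\<^sub>\<alpha> t\<^sub>\<alpha>(x)\<close>.
  A vector bundle is a set with projection, fibrewise linear structure and a vector bundle atlas
  (\<open>vframes\<close>, not required to be maximal); this atlas determines the smooth structure of the
  total space. The rank may be 0, and is locally constant.
\<close>

type_synonym ('f, 'n) frame = "nat \<times> 'n set \<times> (nat \<Rightarrow> 'n \<Rightarrow> 'f)"

record ('f, 'n, 'd) vbundle =
  vbase :: "('n, 'd) manifold"
  vtotal :: "'f set"
  vproj :: "'f \<Rightarrow> 'n"
  vadd :: "'f \<Rightarrow> 'f \<Rightarrow> 'f"
  vscale :: "real \<Rightarrow> 'f \<Rightarrow> 'f"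
  vzero :: "'n \<Rightarrow> 'f"
  vframes :: "('f, 'n) frame set"

definition real_ring :: "real ring" where
  "real_ring =
     \<lparr>carrier = UNIV, monoid.mult = (*), one = 1, ring.zero = 0, add = (+)\<rparr>"

text \<open>Fields \<open>mult\<close> and \<open>one\<close> of a record used as a module carry no meaning.\<close>

definition fibre :: "('f, 'n, 'd) vbundle \<Rightarrow> 'n \<Rightarrow> (real, 'f) module" where
  "fibre F x =
     \<lparr>carrier = {v \<in> vtotal F. vproj F v = x},
      monoid.mult = undefined, one = undefined,
      ring.zero = vzero F x, add = vadd F, smult = vscale F\<rparr>"

definition lincomb ::
  "('f, 'n, 'd) vbundle \<Rightarrow> nat \<Rightarrow> (nat \<Rightarrow> 'n \<Rightarrow> 'f) \<Rightarrow> (nat \<Rightarrow> real) \<Rightarrow> 'n \<Rightarrow> 'f" where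
  "lincomb F k t a x =
     (\<Oplus>\<^bsub>fibre F x\<^esub>\<alpha>\<in>{..<k}. a \<alpha> \<odot>\<^bsub>fibre F x\<^esub> t \<alpha> x)"

definition is_frame :: "('f, 'n, 'd) vbundle \<Rightarrow> ('f, 'n) frame \<Rightarrow> bool" where
  "is_frame F = (\<lambda>(k, U, t). openin (mtop (vbase F)) U \<and>
     (\<forall>x\<in>U. (\<forall>\<alpha><k. t \<alpha> x \<in> carrier (fibre F x)) \<and>
        (\<forall>v\<in>carrier (fibre F x). \<exists>!a. a \<in> {..<k} \<rightarrow>\<^sub>E UNIV \<and> v = lincomb F k t a x)))"

definition frame_coord :: "('f, 'n, 'd) vbundle \<Rightarrow> ('f, 'n) frame \<Rightarrow> 'f \<Rightarrow> nat \<Rightarrow> real" where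
  "frame_coord F = (\<lambda>(k, U, t) v.
     THE a. a \<in> {..<k} \<rightarrow>\<^sub>E UNIV \<and> v = lincomb F k t a (vproj F v))"

definition smooth_local_section ::
  "('f, 'n, 'd::real_inner) vbundle \<Rightarrow> 'n set \<Rightarrow> ('n \<Rightarrow> 'f) \<Rightarrow> bool" where
  "smooth_local_section F W u \<longleftrightarrow>
     (\<forall>x\<in>W. u x \<in> carrier (fibre F x)) \<and>
     (\<forall>(k, U, t)\<in>vframes F. \<forall>\<alpha><k.
        smooth_fun_on (vbase F) (U \<inter> W) (\<lambda>x. frame_coord F (k, U, t) (u x) \<alpha>))"

definition local_base :: "('f, 'n, 'd::real_inner) vbundle \<Rightarrow> ('f, 'n) frame \<Rightarrow> bool" where
  "local_base F = (\<lambda>(k, U, t). is_frame F (k, U, t) \<and>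
     (\<forall>\<alpha><k. smooth_local_section F U (t \<alpha>)))"

definition vector_bundle :: "('f, 'n, 'd::real_inner) vbundle \<Rightarrow> bool" where
  "vector_bundle F \<longleftrightarrow>
     smooth_manifold (vbase F) \<and>
     vproj F ` vtotal F \<subseteq> points (vbase F) \<and>
     (\<forall>x\<in>points (vbase F). Module.module real_ring (fibre F x)) \<and>
     (\<forall>fr\<in>vframes F. local_base F fr) \<and>
     (\<Union>(k, U, t)\<in>vframes F. U) = points (vbase F)"

text \<open>The \<open>\<F>(N)\<close>-module \<open>\<Gamma>(F, \<nu>, N)\<close>.\<close>

definition sections :: "('f, 'n, 'd::real_inner) vbundle \<Rightarrow> ('n \<Rightarrow> real, 'n \<Rightarrow> 'f) module" where
  "sections F =
     \<lparr>carrier = {u \<in> extensional (points (vbase F)). smooth_local_section F (points (vbase F)) u},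
      monoid.mult = undefined, one = undefined,
      ring.zero = (\<lambda>x\<in>points (vbase F). vzero F x),
      add = (\<lambda>u v. \<lambda>x\<in>points (vbase F). vadd F (u x) (v x)),
      smult = (\<lambda>f u. \<lambda>x\<in>points (vbase F). vscale F (f x) (u x))\<rparr>"

text \<open>
  \<open>(\<phi>, \<phi>\<^sub>0)\<close> is a vector bundle morphism covering \<open>\<phi>\<^sub>0\<close>. Given fibrewise linearity and smoothness
  of \<open>\<phi>\<^sub>0\<close>, smoothness of \<open>\<phi>\<close> in vector bundle charts is smoothness of its component functions.
\<close>

definition vb_morphism ::
  "('f, 'n, 'd::real_inner) vbundle \<Rightarrow> ('g, 'm, 'e::real_inner) vbundle \<Rightarrow>
   ('f \<Rightarrow> 'g) \<Rightarrow> ('n \<Rightarrow> 'm) \<Rightarrow> bool" where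
  "vb_morphism F G \<phi> \<phi>\<^sub>0 \<longleftrightarrow>
     smooth_map (vbase F) (vbase G) \<phi>\<^sub>0 \<and>
     (\<forall>x\<in>points (vbase F).
        \<phi> \<in> carrier (fibre F x) \<rightarrow> carrier (fibre G (\<phi>\<^sub>0 x)) \<and>
        (\<forall>v\<in>carrier (fibre F x). \<forall>w\<in>carrier (fibre F x).
           \<phi> (v \<oplus>\<^bsub>fibre F x\<^esub> w) = \<phi> v \<oplus>\<^bsub>fibre G (\<phi>\<^sub>0 x)\<^esub> \<phi> w) \<and>
        (\<forall>a. \<forall>v\<in>carrier (fibre F x).
           \<phi> (a \<odot>\<^bsub>fibre F x\<^esub> v) = a \<odot>\<^bsub>fibre G (\<phi>\<^sub>0 x)\<^esub> \<phi> v)) \<and>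
     (\<forall>(k, U, t)\<in>vframes F. \<forall>(l, V, s)\<in>vframes G. \<forall>\<alpha><k. \<forall>i<l.
        smooth_fun_on (vbase F) (U \<inter> \<phi>\<^sub>0 -` V)
          (\<lambda>x. frame_coord G (l, V, s) (\<phi> (t \<alpha> x)) i))"

text \<open>
  The map on sections induced by a vector bundle morphism \<open>(\<phi>, \<phi>\<^sub>0)\<close> covering a diffeomorphism
  \<open>\<phi>\<^sub>0\<close>: \<open>\<Gamma>(\<phi>, \<phi>\<^sub>0)(u) = \<phi> \<circ> u \<circ> \<phi>\<^sub>0\<^sup>-\<^sup>1\<close>.
\<close>

definition section_map ::
  "('f, 'n, 'd) vbundle \<Rightarrow> ('g, 'm, 'e) vbundle \<Rightarrow> ('f \<Rightarrow> 'g) \<Rightarrow> ('n \<Rightarrow> 'm) \<Rightarrow>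
   ('n \<Rightarrow> 'f) \<Rightarrow> 'm \<Rightarrow> 'g" where
  "section_map F G \<phi> \<phi>\<^sub>0 u =
     (\<lambda>y\<in>points (vbase G). \<phi> (u (inv_into (points (vbase F)) \<phi>\<^sub>0 y)))"


section \<open>The tangent bundle\<close>

text \<open>Derivative of \<open>f\<close> at \<open>p\<close> in the direction with coordinates \<open>v\<close> in the chart \<open>c\<close>;
  for \<open>v\<close> a basis vector \<open>b\<^sub>i\<close> this is \<open>\<partial>f/\<partial>x\<^sup>i\<close> at \<open>p\<close>, with \<open>x\<^sup>i = c \<bullet> b\<^sub>i\<close>.\<close>

definition chart_deriv ::
  "('m, 'e::real_inner) chart \<Rightarrow> 'e \<Rightarrow> ('m \<Rightarrow> real) \<Rightarrow> 'm \<Rightarrow> real" where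
  "chart_deriv c v f p = frechet_derivative (f \<circ> chart_inv c) (at (snd c p)) v"

text \<open>Tangent vectors are represented by their base point and their action on \<open>\<F>(M)\<close>.\<close>

type_synonym 'm tvec = "'m \<times> (('m \<Rightarrow> real) \<Rightarrow> real)"

definition tangent_vector ::
  "('m, 'e::real_inner) manifold \<Rightarrow> ('m, 'e) chart \<Rightarrow> 'e \<Rightarrow> 'm \<Rightarrow> 'm tvec" where
  "tangent_vector M c v p = (p, \<lambda>f\<in>carrier (smooth_functions M). chart_deriv c v f p)"

text \<open>The local frame \<open>(\<partial>/\<partial>x\<^sup>i)\<close> of the coordinates of \<open>c\<close> with respect to an orthonormal basis.\<close>

definition coord_frame ::
  "('m, 'e::real_inner) manifold \<Rightarrow> 'e list \<Rightarrow> ('m, 'e) chart \<Rightarrow> ('m tvec, 'm) frame" where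
  "coord_frame M bs c = (length bs, fst c, \<lambda>i. tangent_vector M c (bs ! i))"

definition tangent_bundle ::
  "('m, 'e::real_inner) manifold \<Rightarrow> ('m tvec, 'm, 'e) vbundle" where
  "tangent_bundle M =
     \<lparr>vbase = M,
      vtotal = {tangent_vector M c v p | c v p. c \<in> charts M \<and> p \<in> fst c},
      vproj = fst,
      vadd = (\<lambda>X Y. (fst X, \<lambda>f\<in>carrier (smooth_functions M). snd X f + snd Y f)),
      vscale = (\<lambda>a X. (fst X, \<lambda>f\<in>carrier (smooth_functions M). a * snd X f)),
      vzero = (\<lambda>p. (p, \<lambda>f\<in>carrier (smooth_functions M). 0)),
      vframes = {coord_frame M bs c | bs c. orthonormal_list bs \<and> c \<in> charts M}\<rparr>"

definition vf_action ::
  "('m, 'e::real_inner) manifold \<Rightarrow> ('m \<Rightarrow> 'm tvec) \<Rightarrow> ('m \<Rightarrow> real) \<Rightarrow> 'm \<Rightarrow> real" where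
  "vf_action M X = (\<lambda>f\<in>carrier (smooth_functions M). \<lambda>x\<in>points M. snd (X x) f)"


section \<open>Generalized Lie algebras and Lie-Rinehart algebras\<close>

definition Der :: "('r, 'a) ring_scheme \<Rightarrow> ('r, 'r \<Rightarrow> 'r) module" where
  "Der R =
     \<lparr>carrier = {D \<in> carrier R \<rightarrow>\<^sub>E carrier R. \<forall>f\<in>carrier R. \<forall>g\<in>carrier R.
         D (f \<oplus>\<^bsub>R\<^esub> g) = D f \<oplus>\<^bsub>R\<^esub> D g \<and>
         D (f \<otimes>\<^bsub>R\<^esub> g) = (D f \<otimes>\<^bsub>R\<^esub> g) \<oplus>\<^bsub>R\<^esub> (f \<otimes>\<^bsub>R\<^esub> D g)},
      monoid.mult = undefined, one = undefined,
      ring.zero = (\<lambda>f\<in>carrier R. \<zero>\<^bsub>R\<^esub>),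
      add = (\<lambda>D E. \<lambda>f\<in>carrier R. D f \<oplus>\<^bsub>R\<^esub> E f),
      smult = (\<lambda>g D. \<lambda>f\<in>carrier R. g \<otimes>\<^bsub>R\<^esub> D f)\<rparr>"

definition der_commutator :: "('r, 'a) ring_scheme \<Rightarrow> ('r \<Rightarrow> 'r) \<Rightarrow> ('r \<Rightarrow> 'r) \<Rightarrow> 'r \<Rightarrow> 'r" where
  "der_commutator R D E = (\<lambda>f\<in>carrier R. D (E f) \<ominus>\<^bsub>R\<^esub> E (D f))"

definition module_morphisms ::
  "('r, 'a) ring_scheme \<Rightarrow> ('r, 'x) module \<Rightarrow> ('r, 'y) module \<Rightarrow> ('x \<Rightarrow> 'y) set" where
  "module_morphisms R A B = {\<phi> \<in> carrier A \<rightarrow> carrier B.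
     (\<forall>u\<in>carrier A. \<forall>v\<in>carrier A. \<phi> (u \<oplus>\<^bsub>A\<^esub> v) = \<phi> u \<oplus>\<^bsub>B\<^esub> \<phi> v) \<and>
     (\<forall>f\<in>carrier R. \<forall>u\<in>carrier A. \<phi> (f \<odot>\<^bsub>A\<^esub> u) = f \<odot>\<^bsub>B\<^esub> \<phi> u)}"

definition lie_prealgebra ::
  "('r, 'a) ring_scheme \<Rightarrow> ('r, 'x) module \<Rightarrow> ('x \<Rightarrow> 'x \<Rightarrow> 'x) \<Rightarrow> bool" where
  "lie_prealgebra R A br \<longleftrightarrow>
     Module.module R A \<and>
     br \<in> carrier A \<rightarrow> carrier A \<rightarrow> carrier A \<and>
     (\<forall>u\<in>carrier A. \<forall>v\<in>carrier A. \<forall>w\<in>carrier A.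
        br (u \<oplus>\<^bsub>A\<^esub> v) w = br u w \<oplus>\<^bsub>A\<^esub> br v w \<and>
        br w (u \<oplus>\<^bsub>A\<^esub> v) = br w u \<oplus>\<^bsub>A\<^esub> br w v) \<and>
     (\<forall>u\<in>carrier A. br u u = \<zero>\<^bsub>A\<^esub>) \<and>
     (\<forall>u\<in>carrier A. \<forall>v\<in>carrier A. \<forall>z\<in>carrier A.
        br u (br v z) \<oplus>\<^bsub>A\<^esub> br z (br u v) \<oplus>\<^bsub>A\<^esub> br v (br z u) = \<zero>\<^bsub>A\<^esub>)"

definition generalized_lie_algebra ::
  "('r, 'a) ring_scheme \<Rightarrow> ('r, 'x) module \<Rightarrow> ('x \<Rightarrow> 'x \<Rightarrow> 'x) \<Rightarrow> ('x \<Rightarrow> 'r \<Rightarrow> 'r) \<Rightarrow> bool" where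
  "generalized_lie_algebra R A br \<rho> \<longleftrightarrow>
     lie_prealgebra R A br \<and>
     \<rho> \<in> module_morphisms R A (Der R) \<and>
     (\<forall>u\<in>carrier A. \<forall>v\<in>carrier A. \<forall>f\<in>carrier R.
        br u (f \<odot>\<^bsub>A\<^esub> v) = (f \<odot>\<^bsub>A\<^esub> br u v) \<oplus>\<^bsub>A\<^esub> (\<rho> u f \<odot>\<^bsub>A\<^esub> v))"

definition lie_algebra ::
  "('k, 'a) ring_scheme \<Rightarrow> ('k, 'x) module \<Rightarrow> ('x \<Rightarrow> 'x \<Rightarrow> 'x) \<Rightarrow> bool" where
  "lie_algebra K L br \<longleftrightarrow>
     lie_prealgebra K L br \<and>
     (\<forall>a\<in>carrier K. \<forall>u\<in>carrier L. \<forall>v\<in>carrier L.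
        br (a \<odot>\<^bsub>L\<^esub> u) v = a \<odot>\<^bsub>L\<^esub> br u v \<and>
        br u (a \<odot>\<^bsub>L\<^esub> v) = a \<odot>\<^bsub>L\<^esub> br u v)"

definition restrict_scalars ::
  "('k \<Rightarrow> 'r) \<Rightarrow> ('r, 'x) module \<Rightarrow> ('k, 'x) module" where
  "restrict_scalars \<iota> A =
     \<lparr>carrier = carrier A, monoid.mult = undefined, one = undefined,
      ring.zero = \<zero>\<^bsub>A\<^esub>, add = add A, smult = (\<lambda>a u. \<iota> a \<odot>\<^bsub>A\<^esub> u)\<rparr>"

text \<open>Lie-Rinehart algebras over \<open>K\<close>, where \<open>\<iota>\<close> makes \<open>R\<close> a \<open>K\<close>-algebra.\<close>

definition lie_rinehart_algebra ::
  "('k, 'a) ring_scheme \<Rightarrow> ('k \<Rightarrow> 'r) \<Rightarrow> ('r, 'b) ring_scheme \<Rightarrow>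
   ('r, 'x) module \<Rightarrow> ('x \<Rightarrow> 'x \<Rightarrow> 'x) \<Rightarrow> ('x \<Rightarrow> 'r \<Rightarrow> 'r) \<Rightarrow> bool" where
  "lie_rinehart_algebra K \<iota> R A br \<rho> \<longleftrightarrow>
     \<iota> \<in> ring_hom K R \<and>
     Module.module R A \<and>
     lie_algebra K (restrict_scalars \<iota> A) br \<and>
     \<rho> \<in> module_morphisms R A (Der R) \<and>
     (\<forall>u\<in>carrier A. \<forall>v\<in>carrier A. \<rho> (br u v) = der_commutator R (\<rho> u) (\<rho> v)) \<and>
     (\<forall>u\<in>carrier A. \<forall>v\<in>carrier A. \<forall>f\<in>carrier R.
        br u (f \<odot>\<^bsub>A\<^esub> v) = (f \<odot>\<^bsub>A\<^esub> br u v) \<oplus>\<^bsub>A\<^esub> (\<rho> u f \<odot>\<^bsub>A\<^esub> v))"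


section \<open>Lie algebroids\<close>

text \<open>\<open>\<Gamma>(\<theta>, Id\<^sub>N)\<close> as a map into \<open>Der(\<F>(N))\<close>.\<close>

definition lie_algebroid_anchor ::
  "('f, 'n, 'd::real_inner) vbundle \<Rightarrow> ('f \<Rightarrow> 'n tvec) \<Rightarrow>
   ('n \<Rightarrow> 'f) \<Rightarrow> ('n \<Rightarrow> real) \<Rightarrow> 'n \<Rightarrow> real" where
  "lie_algebroid_anchor F \<theta> u =
     vf_action (vbase F) (section_map F (tangent_bundle (vbase F)) \<theta> id u)"

definition lie_algebroid ::
  "('f, 'n, 'd::real_inner) vbundle \<Rightarrow> (('n \<Rightarrow> 'f) \<Rightarrow> ('n \<Rightarrow> 'f) \<Rightarrow> ('n \<Rightarrow> 'f)) \<Rightarrow>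
   ('f \<Rightarrow> 'n tvec) \<Rightarrow> bool" where
  "lie_algebroid F br \<theta> \<longleftrightarrow>
     vector_bundle F \<and>
     vb_morphism F (tangent_bundle (vbase F)) \<theta> id \<and>
     lie_rinehart_algebra real_ring (\<lambda>a. \<lambda>x\<in>points (vbase F). a)
       (smooth_functions (vbase F)) (sections F) br (lie_algebroid_anchor F \<theta>)"


section \<open>Generalized Lie algebroids\<close>

text \<open>
  \<open>A\<close> is given by the local formula for \<open>\<Gamma>(Th \<circ> \<rho>, h \<circ> \<eta>)\<close>:
  \<open>A(u\<^sup>\<alpha> t\<^sub>\<alpha>)(f) = u\<^sup>\<alpha> \<rho>\<^sub>\<alpha>\<^sup>i \<cdot> (\<partial>(f \<circ> h)/\<partial>x\<^sup>i \<circ> h\<^sup>-\<^sup>1)\<close> on \<open>W\<close>.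

  At \<open>y\<close>, the formula takes the components \<open>\<rho>\<^sub>\<alpha>\<^sup>i(y)\<close> of a vector at \<open>\<eta>(y)\<close> and the partial
  derivatives at \<open>h\<^sup>-\<^sup>1(y)\<close> in the same coordinates \<open>(x\<^sup>i)\<close>. These two points may differ, so the
  coordinate functions must be defined near both: they are given by a chart \<open>c\<close> around the points
  \<open>\<eta>(y)\<close> and a chart \<open>d\<close> around the points \<open>h\<^sup>-\<^sup>1(y)\<close> which agree on the overlap of their domains,
  i.e. by one coordinate map on \<open>fst c \<union> fst d\<close> (possibly \<open>c = d\<close>). If \<open>\<eta> = h\<^sup>-\<^sup>1\<close>, the
  formula does not depend on the coordinates and says \<open>A(u) = Th \<circ> \<rho> \<circ> u\<close>. Otherwise it does, and
  only its validity in some local base and some coordinates around each point is required, so that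
  no relation between \<open>\<eta>\<close> and \<open>h\<close> is imposed.
\<close>

definition is_generalized_anchor ::
  "('f, 'n, 'd::real_inner) vbundle \<Rightarrow> ('m, 'e::real_inner) manifold \<Rightarrow>
   ('f \<Rightarrow> 'm tvec) \<Rightarrow> ('n \<Rightarrow> 'm) \<Rightarrow> ('m \<Rightarrow> 'n) \<Rightarrow>
   (('n \<Rightarrow> 'f) \<Rightarrow> ('n \<Rightarrow> real) \<Rightarrow> 'n \<Rightarrow> real) \<Rightarrow> bool" where
  "is_generalized_anchor F M \<rho> \<eta> h A \<longleftrightarrow>
     (\<forall>x\<in>points (vbase F). \<exists>k W t. \<exists>c\<in>charts M. \<exists>d\<in>charts M. \<exists>bs.
        x \<in> W \<and> local_base F (k, W, t) \<and> orthonormal_list bs \<and>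
        (\<forall>p\<in>fst c \<inter> fst d. snd c p = snd d p) \<and>
        (\<forall>y\<in>W. \<eta> y \<in> fst c \<and> inv_into (points M) h y \<in> fst d) \<and>
        (\<forall>u\<in>carrier (sections F). \<forall>f\<in>carrier (smooth_functions (vbase F)). \<forall>y\<in>W.
           A u f y =
             (\<Sum>\<alpha><k. \<Sum>i<length bs.
                frame_coord F (k, W, t) (u y) \<alpha> *
                frame_coord (tangent_bundle M) (coord_frame M bs c) (\<rho> (t \<alpha> y)) i *
                chart_deriv d (bs ! i) (f \<circ> h) (inv_into (points M) h y))))"

text \<open>\<open>A\<close> is the anchor map \<open>\<Gamma>(Th \<circ> \<rho>, h \<circ> \<eta>)\<close>.\<close>

definition generalized_lie_algebroid ::
  "('f, 'n, 'd::real_inner) vbundle \<Rightarrow> ('m, 'e::real_inner) manifold \<Rightarrow>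
   (('n \<Rightarrow> 'f) \<Rightarrow> ('n \<Rightarrow> 'f) \<Rightarrow> ('n \<Rightarrow> 'f)) \<Rightarrow>
   ('f \<Rightarrow> 'm tvec) \<Rightarrow> ('n \<Rightarrow> 'm) \<Rightarrow> ('m \<Rightarrow> 'n) \<Rightarrow>
   (('n \<Rightarrow> 'f) \<Rightarrow> ('n \<Rightarrow> real) \<Rightarrow> 'n \<Rightarrow> real) \<Rightarrow> bool" where
  "generalized_lie_algebroid F M br \<rho> \<eta> h A \<longleftrightarrow>
     vector_bundle F \<and> smooth_manifold M \<and>
     diffeomorphism (vbase F) M \<eta> \<and> diffeomorphism M (vbase F) h \<and>
     vb_morphism F (tangent_bundle M) \<rho> \<eta> \<and>
     is_generalized_anchor F M \<rho> \<eta> h A \<and>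
     generalized_lie_algebra (smooth_functions (vbase F)) (sections F) br A"

end

theory Submission
  imports Defs
begin

text \<open>
  The anchor formula shows that \<open>A u f x\<close> depends on the section \<open>u\<close> only through \<open>u x\<close>, and
  that \<open>f \<mapsto> A u f x\<close> is the push-forward under \<open>h\<close> of a tangent vector at \<open>h\<^sup>-\<^sup>1 x\<close>. As every
  vector of \<open>F\<close> is the value of a global section, this defines a fibrewise linear map \<open>\<theta>\<close> over the
  identity of \<open>N\<close> with \<open>\<Gamma>(\<theta>, Id) = A\<close>. Its components are locally of the form \<open>A u f\<close>, where \<open>u\<close>
  extends a member of a local frame and \<open>f\<close> extends a coordinate function, so \<open>\<theta>\<close> is smooth.

  The anchor preserves brackets because the Jacobi identity for \<open>u, v, g \<cdot> w\<close> forces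
  \<open>([A u, A v] g - A [u, v] g) \<cdot> w = 0\<close> for all sections \<open>w\<close>; at a point where all sections vanish,
  \<open>A\<close> vanishes as well.
\<close>

section \<open>Calculus of smooth maps\<close>

text \<open>Two features of the definitions shape the proof. Tangent vectors act on global functions
  only, so a coordinate function or a frame section must be extended from a neighbourhood to all of
  N before \<open>A\<close> can be applied to it; this calls for bump functions. As the model spaces
  are \<open>real_inner\<close> types with an explicit orthonormal basis, the chain rule for
  \<open>Ck_on\<close> and the compactness of closed balls both go through that basis.

  Secondly, \<open>Der\<close> consists of additive derivations, which need not kill the real
  constants: if N is a point, the ring of functions is the field of reals, which has nonzero
  derivations. Hence real bilinearity of the bracket is not a matter of algebra alone; it rests on
  \<open>A u\<close> being tangent at every point.

  The anchor formula pairs components taken at \<eta>(y) with derivatives taken at the preimage of y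
  under h. For fixed y and u these components are just numbers, and every real combination of
  partial derivatives at a point is a tangent vector there, so the two points need not be
  related.\<close>

lemma differentiable_transform_open:
  assumes "open S" "x \<in> S" "\<And>y. y \<in> S \<Longrightarrow> f y = g y" "f differentiable (at x)"
  shows "g differentiable (at x)" "frechet_derivative g (at x) = frechet_derivative f (at x)"
proof -
  have "(f has_derivative frechet_derivative f (at x)) (at x)"
    using assms(4) frechet_derivative_works by blast
  then have *: "(g has_derivative frechet_derivative f (at x)) (at x)"
    using has_derivative_transform_within_open[OF _ assms(1,2)] assms(3) by blast
  show "g differentiable (at x)" using * differentiable_def by blast
  show "frechet_derivative g (at x) = frechet_derivative f (at x)"
    using frechet_derivative_at[OF *] by simp
qed

text \<open>The derivative at x depends only on the germ of the function at x, so on an open set the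
  directional derivatives agree as well and the induction can be applied to them.\<close>

lemma Ck_on_cong:
  assumes "open S" "\<And>x. x \<in> S \<Longrightarrow> f x = g x" "Ck_on k S f"
  shows "Ck_on k S g"
  using assms(2,3)
proof (induction k arbitrary: f g)
  case 0
  then show ?case using continuous_on_cong[of S S f g] by simp
next
  case (Suc k)
  have d: "f differentiable (at x)" if "x \<in> S" for x
    using Suc.prems that by simp
  note t = differentiable_transform_open[OF assms(1) _ Suc.prems(1)]
  have "Ck_on k S (\<lambda>x. frechet_derivative g (at x) v)" for v
    by (rule Suc.IH[of "\<lambda>x. frechet_derivative f (at x) v"]) (use Suc.prems t(2) d in auto)
  then show ?case using t(1) d by auto
qed

lemma Ck_on_subset:
  "T \<subseteq> S \<Longrightarrow> Ck_on k S f \<Longrightarrow> Ck_on k T f"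
  by (induction k arbitrary: f) (auto intro: continuous_on_subset)

text \<open>\<open>Ck_on\<close> takes derivatives in the whole space and not within S, so each of
  its clauses follows from what happens near single points; S may be arbitrary.\<close>

lemma Ck_on_local:
  assumes "\<And>x. x \<in> S \<Longrightarrow> \<exists>T. open T \<and> x \<in> T \<and> Ck_on k T f"
  shows "Ck_on k S f"
  using assms
proof (induction k arbitrary: f)
  case 0
  have "continuous (at x) f" if "x \<in> S" for x
    using 0[OF that] continuous_on_eq_continuous_at by auto
  then show ?case by (simp add: continuous_at_imp_continuous_on)
next
  case (Suc k)
  have "f differentiable (at x)" if "x \<in> S" for x
    using Suc.prems[OF that] by auto
  moreover have "Ck_on k S (\<lambda>x. frechet_derivative f (at x) v)" for v
    by (rule Suc.IH) (use Suc.prems in force)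
  ultimately show ?case by simp
qed

lemma Ck_on_Suc_imp: "Ck_on (Suc k) S f \<Longrightarrow> Ck_on k S f"
proof (induction k arbitrary: f)
  case 0
  then show ?case
    by (simp add: differentiable_imp_continuous_within continuous_at_imp_continuous_on)
next
  case (Suc k)
  then show ?case by auto
qed

lemma Ck_on_const: "Ck_on k S (\<lambda>x. c)"
  by (induction k arbitrary: c) (auto simp: frechet_derivative_const)

lemma Ck_on_bounded_linear_compose:
  assumes "open S" "bounded_linear L" "Ck_on k S f"
  shows "Ck_on k S (\<lambda>x. L (f x))"
  using assms(3)
proof (induction k arbitrary: f)
  case 0
  then show ?case
    by (simp add: bounded_linear.continuous_on[OF assms(2)])
next
  case (Suc k)
  have D: "((\<lambda>x. L (f x)) has_derivative (\<lambda>v. L (frechet_derivative f (at x) v))) (at x)"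
    if "x \<in> S" for x
    using Suc.prems that
    by (auto intro!: bounded_linear.has_derivative[OF assms(2)] simp: frechet_derivative_works)
  have "Ck_on k S (\<lambda>x. frechet_derivative (\<lambda>x. L (f x)) (at x) v)" for v
    by (rule Ck_on_cong[OF assms(1) _ Suc.IH[of "\<lambda>x. frechet_derivative f (at x) v"]])
      (use Suc.prems frechet_derivative_at[OF D, symmetric] in auto)
  then show ?case using differentiableI[OF D] by auto
qed

lemma Ck_on_bounded_linear:
  assumes "open S" "bounded_linear L"
  shows "Ck_on k S L"
proof (cases k)
  case 0
  then show ?thesis using assms(2) by (simp add: linear_continuous_on)
next
  case (Suc m)
  have D: "(L has_derivative L) (at x)" for x
    using assms(2) bounded_linear_imp_has_derivative by blast
  then have "L differentiable (at x)" for x using differentiable_def by blast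
  moreover have "frechet_derivative L (at x) = L" for x
    using frechet_derivative_at[OF D] by simp
  ultimately show ?thesis using Suc by (simp add: Ck_on_const)
qed

lemma Ck_on_add:
  assumes "open S" "Ck_on k S f" "Ck_on k S g"
  shows "Ck_on k S (\<lambda>x. f x + g x)"
  using assms(2,3)
proof (induction k arbitrary: f g)
  case 0
  then show ?case by (simp add: continuous_on_add)
next
  case (Suc k)
  let ?D = "\<lambda>f x. frechet_derivative f (at x)"
  have D: "((\<lambda>x. f x + g x) has_derivative (\<lambda>v. ?D f x v + ?D g x v)) (at x)" if "x \<in> S" for x
    using Suc.prems that by (auto intro!: has_derivative_add simp: frechet_derivative_works)
  have "Ck_on k S (\<lambda>x. ?D (\<lambda>x. f x + g x) x v)" for v
    by (rule Ck_on_cong[OF assms(1) _ Suc.IH[of "\<lambda>x. ?D f x v" "\<lambda>x. ?D g x v"]])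
      (use Suc.prems frechet_derivative_at[OF D, symmetric] in auto)
  then show ?case using differentiableI[OF D] by auto
qed

lemma Ck_on_scaleR:
  fixes f :: "'a::real_normed_vector \<Rightarrow> real"
  assumes "open S" "Ck_on k S f" "Ck_on k S g"
  shows "Ck_on k S (\<lambda>x. f x *\<^sub>R g x)"
  using assms(2,3)
proof (induction k arbitrary: f g)
  case 0
  then show ?case by (simp add: continuous_on_scaleR)
next
  case (Suc k)
  let ?D = "\<lambda>f x. frechet_derivative f (at x)"
  have D: "((\<lambda>x. f x *\<^sub>R g x) has_derivative (\<lambda>v. f x *\<^sub>R ?D g x v + ?D f x v *\<^sub>R g x)) (at x)"
    if "x \<in> S" for x
    using Suc.prems that by (auto intro!: has_derivative_scaleR simp: frechet_derivative_works)
  have "Ck_on k S (\<lambda>x. ?D (\<lambda>x. f x *\<^sub>R g x) x v)" for v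
    by (rule Ck_on_cong[OF assms(1) _ Ck_on_add[OF assms(1) Suc.IH[of f "\<lambda>x. ?D g x v"]
            Suc.IH[of "\<lambda>x. ?D f x v" g]]])
      (use Suc.prems frechet_derivative_at[OF D, symmetric] Ck_on_Suc_imp[OF Suc.prems(1)]
          Ck_on_Suc_imp[OF Suc.prems(2)] in auto)
  then show ?case using differentiableI[OF D] by auto
qed

lemma Ck_on_mult:
  fixes f g :: "'a::real_normed_vector \<Rightarrow> real"
  assumes "open S" "Ck_on k S f" "Ck_on k S g"
  shows "Ck_on k S (\<lambda>x. f x * g x)"
  using Ck_on_scaleR[OF assms] by simp

lemma Ck_on_sum:
  assumes "open S" "\<And>i. i \<in> I \<Longrightarrow> Ck_on k S (f i)"
  shows "Ck_on k S (\<lambda>x. \<Sum>i\<in>I. f i x)"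
  using assms(2)
proof (induction I rule: infinite_finite_induct)
  case (insert i I)
  then show ?case using Ck_on_add[OF assms(1), of k "f i" "\<lambda>x. \<Sum>i\<in>I. f i x"] by simp
qed (simp_all add: Ck_on_const)

lemma orthonormal_list_expansion:
  fixes bs :: "'e::real_inner list"
  assumes "orthonormal_list bs"
  shows "(\<Sum>i<length bs. (v \<bullet> bs ! i) *\<^sub>R bs ! i) = v"
proof -
  let ?P = "\<lambda>v. \<Sum>i<length bs. (v \<bullet> bs ! i) *\<^sub>R bs ! i"
  have lin: "linear ?P"
    by (auto intro!: linearI simp: inner_add_left algebra_simps sum.distrib scaleR_sum_right)
  have "?P (bs ! j) = bs ! j" if "j < length bs" for j
  proof -
    have "?P (bs ! j) = (\<Sum>i<length bs. if i = j then bs ! i else 0)"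
      using assms that by (intro sum.cong) (auto simp: orthonormal_list_def)
    then show ?thesis using that by simp
  qed
  then have "?P b = id b" if "b \<in> set bs" for b
    using that by (auto simp: in_set_conv_nth)
  moreover have "v \<in> span (set bs)" using assms by (simp add: orthonormal_list_def)
  ultimately have "?P v = id v"
    using linear_eq_on_span[OF lin linear_id] by blast
  then show ?thesis by simp
qed

text \<open>By the chain rule the derivative of the composite in direction v is Df(g x) applied to a
  direction that varies with x, whereas \<open>Ck_on\<close> controls only fixed directions.
  Expanding that direction in \<open>bs\<close> gives a finite sum of scalar functions times partial
  derivatives of f composed with g, and the induction hypothesis applies to the latter.\<close>

lemma Ck_on_compose:
  fixes g :: "'a::real_normed_vector \<Rightarrow> 'e::real_inner" and f :: "'e \<Rightarrow> 'b::real_normed_vector"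
    and bs :: "'e list"
  assumes "open S" "orthonormal_list bs" "g ` S \<subseteq> T" "Ck_on k T f" "Ck_on k S g"
  shows "Ck_on k S (f \<circ> g)"
  using assms(3-5)
proof (induction k arbitrary: f)
  case 0
  then show ?case
    by (auto intro: continuous_on_compose[unfolded o_def] continuous_on_subset)
next
  case (Suc k)
  let ?D = "\<lambda>f x. frechet_derivative f (at x)"
  have df: "(f has_derivative ?D f (g x)) (at (g x))" if "x \<in> S" for x
    using Suc.prems that by (auto simp: frechet_derivative_works)
  have dg: "(g has_derivative ?D g x) (at x)" if "x \<in> S" for x
    using Suc.prems that by (auto simp: frechet_derivative_works)
  have D: "(f \<circ> g has_derivative (\<lambda>v. ?D f (g x) (?D g x v))) (at x)" if "x \<in> S" for x
    using diff_chain_at[OF dg df] that by (simp add: o_def)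
  have expand: "?D f (g x) w = (\<Sum>i<length bs. (w \<bullet> bs ! i) *\<^sub>R ?D f (g x) (bs ! i))"
    if "x \<in> S" for x w
  proof -
    have lin: "linear (?D f (g x))" using df[OF that] has_derivative_linear by blast
    have "?D f (g x) w = ?D f (g x) (\<Sum>i<length bs. (w \<bullet> bs ! i) *\<^sub>R bs ! i)"
      using orthonormal_list_expansion[OF assms(2), of w] by simp
    then show ?thesis by (simp add: linear_sum[OF lin] linear_cmul[OF lin])
  qed
  have "Ck_on k S (\<lambda>x. ?D (f \<circ> g) x v)" for v
  proof (rule Ck_on_cong[OF assms(1)])
    show "(\<Sum>i<length bs. (?D g x v \<bullet> bs ! i) *\<^sub>R ((\<lambda>y. ?D f y (bs ! i)) \<circ> g) x) = ?D (f \<circ> g) x v"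
      if "x \<in> S" for x
      using expand[OF that, of "?D g x v"] frechet_derivative_at[OF D[OF that]]
      by (metis (no_types, lifting) comp_apply sum.cong)
    show "Ck_on k S (\<lambda>x. \<Sum>i<length bs. (?D g x v \<bullet> bs ! i) *\<^sub>R ((\<lambda>y. ?D f y (bs ! i)) \<circ> g) x)"
      using Suc.prems Ck_on_Suc_imp[OF Suc.prems(3)]
      by (intro Ck_on_sum Ck_on_scaleR assms(1) Suc.IH
          Ck_on_bounded_linear_compose[OF assms(1) bounded_linear_inner_left]) auto
  qed
  then show ?case unfolding Ck_on.simps using differentiableI[OF D] by blast
qed

lemma smooth_on_cong:
  "open S \<Longrightarrow> (\<And>x. x \<in> S \<Longrightarrow> f x = g x) \<Longrightarrow> smooth_on S f \<Longrightarrow> smooth_on S g"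
  unfolding smooth_on_def using Ck_on_cong by blast

lemma smooth_on_subset: "T \<subseteq> S \<Longrightarrow> smooth_on S f \<Longrightarrow> smooth_on T f"
  unfolding smooth_on_def using Ck_on_subset by blast

lemma smooth_on_local:
  "(\<And>x. x \<in> S \<Longrightarrow> \<exists>T. open T \<and> x \<in> T \<and> smooth_on T f) \<Longrightarrow> smooth_on S f"
  unfolding smooth_on_def by (meson Ck_on_local)

lemma smooth_on_const: "smooth_on S (\<lambda>x. c)"
  unfolding smooth_on_def using Ck_on_const by blast

lemma smooth_on_mult:
  fixes f g :: "'a::real_normed_vector \<Rightarrow> real"
  shows "open S \<Longrightarrow> smooth_on S f \<Longrightarrow> smooth_on S g \<Longrightarrow> smooth_on S (\<lambda>x. f x * g x)"
  unfolding smooth_on_def using Ck_on_mult by blast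

lemma smooth_on_compose:
  fixes g :: "'a::real_normed_vector \<Rightarrow> 'e::real_inner" and f :: "'e \<Rightarrow> 'b::real_normed_vector"
    and bs :: "'e list"
  assumes "open S" "orthonormal_list bs" "g ` S \<subseteq> T" "smooth_on T f" "smooth_on S g"
  shows "smooth_on S (f \<circ> g)"
  using assms unfolding smooth_on_def by (blast intro: Ck_on_compose)

lemma smooth_on_imp_differentiable: "smooth_on S f \<Longrightarrow> x \<in> S \<Longrightarrow> f differentiable (at x)"
  unfolding smooth_on_def using Ck_on.simps(2) by blast

section \<open>A smooth cutoff function on the real line\<close>

lemma orthonormal_list_real: "orthonormal_list [1::real]"
proof -
  have "x \<in> span {1}" for x :: real
    using span_mul[OF span_base, of "1::real" "{1}" x] by simp
  then show ?thesis by (auto simp: orthonormal_list_def)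
qed

text \<open>For n = 0 this is the classical smooth function that is flat at 0. The powers of t in
  the denominator make the family closed under differentiation up to linear combinations, so that
  smoothness is an induction on the order for all n at once.\<close>

definition flat_exp :: "nat \<Rightarrow> real \<Rightarrow> real" where
  "flat_exp n t = (if t > 0 then exp (- (1 / t)) / t ^ n else 0)"

text \<open>With s = 1/t the limit from the right is that of s^n / exp s at infinity; from the left
  the function is zero.\<close>

lemma flat_exp_tendsto_0: "(flat_exp n \<longlongrightarrow> 0) (at 0)"
proof -
  have "((\<lambda>t::real. (inverse t) ^ n / exp (inverse t)) \<longlongrightarrow> 0) (at_right 0)"
    using filterlim_compose[OF tendsto_power_div_exp_0 filterlim_inverse_at_top_right] .
  then have "(flat_exp n \<longlongrightarrow> 0) (at_right 0)"
    by (rule Lim_transform_eventually)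
      (auto simp: eventually_at_right_field flat_exp_def exp_minus field_simps intro!: exI[of _ 1])
  moreover have "(flat_exp n \<longlongrightarrow> 0) (at_left 0)"
    by (rule Lim_transform_eventually[OF tendsto_const])
      (auto simp: eventually_at_left_field flat_exp_def intro!: exI[of _ "-1"])
  ultimately show ?thesis by (simp add: filterlim_split_at)
qed

lemma flat_exp_deriv:
  "(flat_exp n has_real_derivative flat_exp (n + 2) t - real n * flat_exp (n + 1) t) (at t)"
proof -
  consider "t > 0" | "t < 0" | "t = 0" by linarith
  then show ?thesis
  proof cases
    case 1
    have pow: "m = 0" if "t ^ m \<noteq> t * t ^ (m - Suc 0)" for m
      using that by (cases m) auto
    have "((\<lambda>t. exp (- (1 / t)) / t ^ n) has_real_derivative
        flat_exp (n + 2) t - real n * flat_exp (n + 1) t) (at t)"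
      using 1 by (cases n; auto intro!: derivative_eq_intros
          simp: flat_exp_def field_simps power2_eq_square dest: pow)
    then show ?thesis
      by (rule has_field_derivative_transform_within_open[of _ _ _ "{0<..}"])
        (use 1 in \<open>auto simp: flat_exp_def\<close>)
  next
    case 2
    have "((\<lambda>t. 0) has_real_derivative flat_exp (n + 2) t - real n * flat_exp (n + 1) t) (at t)"
      using 2 by (simp add: flat_exp_def)
    then show ?thesis
      by (rule has_field_derivative_transform_within_open[of _ _ _ "{..<0}"])
        (use 2 in \<open>auto simp: flat_exp_def\<close>)
  next
    case 3
    \<comment> \<open>The difference quotient of \<open>flat_exp n\<close> at 0 is
      \<open>flat_exp (n + 1)\<close>, because \<open>flat_exp n 0\<close> is 0; its limit is
      known.\<close>
    have "((\<lambda>y. (flat_exp n y - flat_exp n 0) / (y - 0)) \<longlongrightarrow> 0) (at 0)"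
      by (rule Lim_transform_eventually[OF flat_exp_tendsto_0[of "n + 1"]])
        (auto simp: eventually_at_filter flat_exp_def)
    then show ?thesis using 3 by (simp add: has_field_derivative_iff flat_exp_def)
  qed
qed

lemma Ck_on_flat_exp: "Ck_on k UNIV (flat_exp n)"
proof (induction k arbitrary: n)
  case 0
  then show ?case
    using DERIV_isCont[OF flat_exp_deriv] by (auto intro!: continuous_at_imp_continuous_on)
next
  case (Suc k)
  have D: "(flat_exp n has_derivative (\<lambda>v. v * (flat_exp (n + 2) t - real n * flat_exp (n + 1) t))) (at t)"
    for t
    using flat_exp_deriv[of n t] unfolding has_field_derivative_def by (metis (no_types, lifting) ext mult.commute)
  have "Ck_on k UNIV (\<lambda>t. v * (flat_exp (n + 2) t + (- real n) * flat_exp (n + 1) t))" for v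
    by (intro Ck_on_mult Ck_on_add Ck_on_const Suc.IH open_UNIV)
  then have "Ck_on k UNIV (\<lambda>t. frechet_derivative (flat_exp n) (at t) v)" for v
    using frechet_derivative_at[OF D, symmetric] by simp
  then show ?case using differentiableI[OF D] by auto
qed

text \<open>Composing \<open>flat_exp 0\<close> with itself makes the cutoff exactly constant on both sides without
  dividing functions.\<close>

lemma smooth_real_cutoff:
  fixes c :: real
  assumes "0 < c"
  obtains \<psi> a where "smooth_on UNIV \<psi>" "0 < a" "\<And>t. t \<le> a \<Longrightarrow> \<psi> t = (1::real)"
    "\<And>t. c \<le> t \<Longrightarrow> \<psi> t = 0"
proof -
  define g where "g t = flat_exp 0 (c - t)" for t
  \<comment> \<open>As \<open>g\<close> is nonincreasing, it is at least \<open>e\<close> up to c/2,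
    so \<open>m\<close> vanishes there; from c on \<open>g\<close> is 0, so \<open>m\<close> equals
    \<open>flat_exp 0 e\<close>, the number by which it is normalized below.\<close>
  define e where "e = g (c / 2)"
  define m where "m t = flat_exp 0 (e - g t)" for t
  have e: "e > 0" using assms by (simp add: e_def g_def flat_exp_def)
  have compose: "Ck_on k UNIV (\<lambda>t. flat_exp 0 (b - f t))" if "Ck_on k UNIV f"
    for k b and f :: "real \<Rightarrow> real"
  proof -
    have "Ck_on k UNIV (\<lambda>t. b + (- 1) * f t)"
      by (intro Ck_on_add Ck_on_mult Ck_on_const that open_UNIV)
    then show ?thesis
      using Ck_on_compose[OF open_UNIV orthonormal_list_real _ Ck_on_flat_exp[of k 0],
          of "\<lambda>t. b - f t"] by (simp add: o_def)
  qed
  have "Ck_on k UNIV (\<lambda>t. 1 + (- inverse (flat_exp 0 e)) * m t)" for k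
    unfolding m_def g_def
    by (intro Ck_on_add Ck_on_mult Ck_on_const open_UNIV compose
        Ck_on_bounded_linear[OF open_UNIV bounded_linear_ident])
  then have "smooth_on UNIV (\<lambda>t. 1 + (- inverse (flat_exp 0 e)) * m t)"
    by (simp add: smooth_on_def)
  moreover have "m t = 0" if "t \<le> c / 2" for t
    using that assms by (auto simp: m_def e_def g_def flat_exp_def field_simps)
  moreover have "m t = flat_exp 0 e" if "c \<le> t" for t
    using that by (simp add: m_def g_def flat_exp_def)
  moreover have "flat_exp 0 e > 0" using e by (simp add: flat_exp_def)
  ultimately show thesis using that[of _ "c / 2"] assms by auto
qed

section \<open>Smooth functions on manifolds\<close>

lemma is_chart_subset: "is_chart X c \<Longrightarrow> fst c \<subseteq> topspace X"
  by (simp add: is_chart_def openin_subset)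

lemma chart_inv_left: "is_chart X c \<Longrightarrow> x \<in> fst c \<Longrightarrow> chart_inv c (snd c x) = x"
proof -
  assume c: "is_chart X c" and x: "x \<in> fst c"
  have "topspace (subtopology X (fst c)) = fst c"
    using is_chart_subset[OF c] by auto
  then have "inj_on (snd c) (fst c)"
    using homeomorphic_imp_injective_map[of "subtopology X (fst c)"] c
    by (metis is_chart_def)
  then show ?thesis using x by (simp add: chart_inv_def)
qed

lemma chart_open_image:
  assumes "is_chart X c" "openin X U"
  shows "open (snd c ` (fst c \<inter> U))"
proof -
  have "open_map (subtopology X (fst c)) (top_of_set (snd c ` fst c)) (snd c)"
    using assms(1) homeomorphic_imp_open_map by (auto simp: is_chart_def)
  moreover have "openin (subtopology X (fst c)) (fst c \<inter> U)"
    using assms(2) by (auto simp: openin_subtopology_Int2)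
  ultimately have "openin (top_of_set (snd c ` fst c)) (snd c ` (fst c \<inter> U))"
    by (auto simp: open_map_def)
  then show ?thesis using assms(1) openin_open_trans by (auto simp: is_chart_def)
qed

lemma chart_continuous_map:
  assumes "is_chart X c"
  shows "continuous_map (subtopology X (fst c)) euclidean (snd c)"
  using assms homeomorphic_imp_continuous_map continuous_map_in_subtopology
  unfolding is_chart_def by blast

lemma chart_inv_continuous_map:
  assumes "is_chart X c"
  shows "continuous_map (top_of_set (snd c ` fst c)) X (chart_inv c)"
proof -
  have "openin (top_of_set (snd c ` fst c)) {y \<in> snd c ` fst c. chart_inv c y \<in> V}"
    if "openin X V" for V
  proof -
    have "{y \<in> snd c ` fst c. chart_inv c y \<in> V} = snd c ` (fst c \<inter> V)"
      by (auto simp: chart_inv_left[OF assms])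
    moreover have "snd c ` (fst c \<inter> V) \<subseteq> snd c ` fst c" by blast
    ultimately show ?thesis using chart_open_image[OF assms that] by (simp add: open_subset)
  qed
  moreover have "chart_inv c y \<in> topspace X" if "y \<in> snd c ` fst c" for y
    using that chart_inv_left[OF assms] is_chart_subset[OF assms] by auto
  ultimately show ?thesis by (auto simp: continuous_map_def)
qed

lemma smooth_manifold_is_chart: "smooth_manifold M \<Longrightarrow> c \<in> charts M \<Longrightarrow> is_chart (mtop M) c"
  by (simp add: smooth_manifold_def)

lemma smooth_manifold_openin_chart: "smooth_manifold M \<Longrightarrow> c \<in> charts M \<Longrightarrow> openin (mtop M) (fst c)"
  by (simp add: smooth_manifold_def is_chart_def)

lemma smooth_manifold_obtain_chart:
  assumes "smooth_manifold M" "x \<in> points M"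
  obtains c where "c \<in> charts M" "x \<in> fst c"
  using assms unfolding smooth_manifold_def by blast

lemma smooth_manifold_obtain_basis:
  fixes M :: "('m, 'e::real_inner) manifold"
  assumes "smooth_manifold M"
  obtains bs :: "'e list" where "orthonormal_list bs"
  using assms unfolding smooth_manifold_def by blast

text \<open>Heine-Borel by way of coordinates: the ball is a closed subset of the image of the cube
  with side [-r, r] under the continuous map \<open>L\<close>, and the cube is compact as a product.
  Cauchy-Schwarz bounds the coordinates of a point of the ball by r. Without a finite basis the
  statement would be false, as a \<open>real_inner\<close> type can be infinite-dimensional.\<close>

lemma compact_cball_orthonormal:
  fixes bs :: "'e::real_inner list"
  assumes "orthonormal_list bs"
  shows "compact (cball (x::'e) r)"
proof -
  let ?X = "product_topology (\<lambda>_. euclideanreal) {..<length bs}"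
  let ?K = "{..<length bs} \<rightarrow>\<^sub>E {- r..r}"
  define L where "L a = x + (\<Sum>i<length bs. a i *\<^sub>R bs ! i)" for a
  have "continuous_map ?X euclidean (\<lambda>a. a i *\<^sub>R bs ! i)" if "i < length bs" for i
  proof -
    have "continuous_on UNIV (\<lambda>t::real. t *\<^sub>R bs ! i)" by (intro continuous_intros)
    then show ?thesis
      using continuous_map_compose[OF continuous_map_product_projection[of i "{..<length bs}" "\<lambda>_. euclideanreal"],
          of euclidean "\<lambda>t. t *\<^sub>R bs ! i"] that by (simp add: o_def)
  qed
  then have "continuous_map ?X euclidean L"
    unfolding L_def by (intro continuous_intros) auto
  moreover have "compactin ?X ?K"
    by (auto simp: compactin_PiE)
  ultimately have "compact (L ` ?K)"
    using image_compactin by fastforce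
  moreover have "cball x r \<subseteq> L ` ?K"
  proof
    fix y assume y: "y \<in> cball x r"
    let ?a = "\<lambda>i\<in>{..<length bs}. (y - x) \<bullet> bs ! i"
    have "\<bar>(y - x) \<bullet> bs ! i\<bar> \<le> r" if "i < length bs" for i
    proof -
      have "bs ! i \<bullet> bs ! i = 1" using that assms by (simp add: orthonormal_list_def)
      then have "norm (bs ! i) = 1" by (simp add: norm_eq_1)
      then show ?thesis
        using Cauchy_Schwarz_ineq2[of "y - x" "bs ! i"] y
        by (simp add: dist_norm norm_minus_commute)
    qed
    then have "?a \<in> ?K" by (simp add: abs_le_iff minus_le_iff)
    moreover have "L ?a = y"
      using orthonormal_list_expansion[OF assms, of "y - x"] by (simp add: L_def)
    ultimately show "y \<in> L ` ?K" by (metis imageI)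
  qed
  ultimately show ?thesis
    using closed_cball compact_Int_closed[of "L ` ?K" "cball x r"] by (simp add: Int_absorb1)
qed

section \<open>Locality of smoothness, bump functions and extension of germs\<close>

lemma smooth_fun_on_cong:
  assumes "smooth_manifold M" "openin (mtop M) U" "\<And>x. x \<in> U \<Longrightarrow> f x = g x" "smooth_fun_on M U f"
  shows "smooth_fun_on M U g"
  unfolding smooth_fun_on_def
proof
  fix c assume c: "c \<in> charts M"
  note ch = smooth_manifold_is_chart[OF assms(1) c]
  show "smooth_on (snd c ` (fst c \<inter> U)) (g \<circ> chart_inv c)"
  proof (rule smooth_on_cong[OF chart_open_image[OF ch assms(2)]])
    show "smooth_on (snd c ` (fst c \<inter> U)) (f \<circ> chart_inv c)"
      using assms(4) c by (simp add: smooth_fun_on_def)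
  qed (auto simp: chart_inv_left[OF ch] assms(3))
qed

lemma smooth_fun_on_subset: "V \<subseteq> U \<Longrightarrow> smooth_fun_on M U f \<Longrightarrow> smooth_fun_on M V f"
  unfolding smooth_fun_on_def
  by (meson Int_mono image_mono smooth_on_subset subset_refl)

text \<open>This is the tool for functions defined by cases: near each point it suffices to name one
  smooth formula \<open>g\<close> that agrees with \<open>f\<close> there.\<close>

lemma smooth_fun_on_local:
  assumes "smooth_manifold M"
    and "\<And>x. x \<in> U \<Longrightarrow> \<exists>V g. openin (mtop M) V \<and> x \<in> V \<and> smooth_fun_on M V g \<and> (\<forall>y\<in>V. g y = f y)"
  shows "smooth_fun_on M U f"
  unfolding smooth_fun_on_def
proof
  fix c assume c: "c \<in> charts M"
  note ch = smooth_manifold_is_chart[OF assms(1) c]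
  show "smooth_on (snd c ` (fst c \<inter> U)) (f \<circ> chart_inv c)"
  proof (rule smooth_on_local)
    fix p assume "p \<in> snd c ` (fst c \<inter> U)"
    then obtain x where x: "x \<in> fst c" "x \<in> U" "p = snd c x" by auto
    obtain V g where V: "openin (mtop M) V" "x \<in> V" "smooth_fun_on M V g" "\<forall>y\<in>V. g y = f y"
      using assms(2)[OF x(2)] by blast
    have "smooth_fun_on M V f" using smooth_fun_on_cong[OF assms(1) V(1) _ V(3)] V(4) by blast
    then show "\<exists>T. open T \<and> p \<in> T \<and> smooth_on T (f \<circ> chart_inv c)"
      using chart_open_image[OF ch V(1)] x V(2) c unfolding smooth_fun_on_def by blast
  qed
qed

lemma smooth_fun_on_const: "smooth_fun_on M U (\<lambda>x. a)"
  by (simp add: smooth_fun_on_def o_def smooth_on_const)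

lemma smooth_fun_on_mult:
  assumes "smooth_manifold M" "openin (mtop M) U" "smooth_fun_on M U f" "smooth_fun_on M U g"
  shows "smooth_fun_on M U (\<lambda>x. f x * g x)"
  unfolding smooth_fun_on_def
proof
  fix c assume c: "c \<in> charts M"
  show "smooth_on (snd c ` (fst c \<inter> U)) ((\<lambda>x. f x * g x) \<circ> chart_inv c)"
    using smooth_on_mult[OF chart_open_image[OF smooth_manifold_is_chart[OF assms(1) c] assms(2)],
        of "f \<circ> chart_inv c" "g \<circ> chart_inv c"] assms(3,4) c
    by (simp add: smooth_fun_on_def o_def)
qed

text \<open>Seen in another chart d, the function is \<beta> after the transition map from d to c,
  which is smooth by compatibility of the charts.\<close>

lemma smooth_fun_on_chart_compose:
  fixes M :: "('m, 'e::real_inner) manifold"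
  assumes "smooth_manifold M" "c \<in> charts M" "smooth_on UNIV \<beta>"
  shows "smooth_fun_on M (fst c) (\<lambda>x. \<beta> (snd c x))"
  unfolding smooth_fun_on_def
proof
  fix d assume d: "d \<in> charts M"
  obtain bs :: "'e list" where bs: "orthonormal_list bs"
    using smooth_manifold_obtain_basis[OF assms(1)] .
  have "smooth_on (snd d ` (fst d \<inter> fst c)) (snd c \<circ> chart_inv d)"
    using assms(1,2) d unfolding smooth_manifold_def compatible_charts_def by blast
  moreover have "open (snd d ` (fst d \<inter> fst c))"
    using assms(1,2) d chart_open_image smooth_manifold_is_chart smooth_manifold_openin_chart by metis
  ultimately show "smooth_on (snd d ` (fst d \<inter> fst c)) ((\<lambda>x. \<beta> (snd c x)) \<circ> chart_inv d)"
    using smooth_on_compose[OF _ bs _ assms(3), of _ "snd c \<circ> chart_inv d"] by (simp add: o_def)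
qed

text \<open>In a chart around x the function is a cutoff of the squared distance, and it is extended
  by zero. The extension is smooth because it vanishes off the preimage \<open>K\<close> of a closed
  ball: \<open>K\<close> is compact, hence closed in the Hausdorff space M, so the chart domain and
  the complement of \<open>K\<close> are open sets covering M with one smooth formula on each. The
  set \<open>C\<close> is returned so that products with local objects can be extended by zero in
  the same manner.\<close>

lemma smooth_functions_bump:
  fixes M :: "('m, 'e::real_inner) manifold"
  assumes M: "smooth_manifold M" and U: "openin (mtop M) U" "x \<in> U"
  obtains b V C where "b \<in> carrier (smooth_functions M)" "openin (mtop M) V" "x \<in> V" "V \<subseteq> U"
    "closedin (mtop M) C" "C \<subseteq> U" "\<And>y. y \<in> V \<Longrightarrow> b y = 1" "\<And>y. y \<in> points M - C \<Longrightarrow> b y = 0"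
proof -
  have "x \<in> points M" using U openin_subset by auto
  then obtain c where c: "c \<in> charts M" "x \<in> fst c"
    using smooth_manifold_obtain_chart[OF M] by blast
  note ch = smooth_manifold_is_chart[OF M c(1)]
  obtain bs :: "'e list" where bs: "orthonormal_list bs"
    using smooth_manifold_obtain_basis[OF M] .
  define p where "p = snd c x"
  obtain r where r: "r > 0" "cball p r \<subseteq> snd c ` (fst c \<inter> U)"
    using chart_open_image[OF ch U(1)] c(2) U(2) unfolding p_def
    by (metis IntI imageI open_contains_cball)
  \<comment> \<open>The threshold is the square of r because the cutoff is applied to the squared
    distance, which unlike the distance is smooth at the centre as well.\<close>
  obtain \<psi> a where \<psi>: "smooth_on UNIV \<psi>" "0 < a" "\<And>t. t \<le> a \<Longrightarrow> \<psi> t = (1::real)"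
    "\<And>t. r\<^sup>2 \<le> t \<Longrightarrow> \<psi> t = 0"
    using smooth_real_cutoff[of "r\<^sup>2"] r(1) by (auto simp: zero_less_power)
  define q where "q v = (v - p) \<bullet> (v - p)" for v
  define \<beta> where "\<beta> v = \<psi> (q v)" for v
  have "smooth_on UNIV q"
  proof -
    \<comment> \<open>In coordinates with respect to \<open>bs\<close> the squared distance is a
      polynomial, so the closure of \<open>Ck_on\<close> under sums and products suffices.\<close>
    have "Ck_on k UNIV (\<lambda>v. \<Sum>i<length bs. (v \<bullet> bs ! i + - p \<bullet> bs ! i) * (v \<bullet> bs ! i + - p \<bullet> bs ! i))" for k
      by (intro Ck_on_sum Ck_on_mult Ck_on_add Ck_on_const open_UNIV
          Ck_on_bounded_linear bounded_linear_inner_left)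
    moreover have "(\<Sum>i<length bs. (v \<bullet> bs ! i + - p \<bullet> bs ! i) * (v \<bullet> bs ! i + - p \<bullet> bs ! i)) = q v" for v
    proof -
      have "q v = (v - p) \<bullet> (\<Sum>i<length bs. ((v - p) \<bullet> bs ! i) *\<^sub>R bs ! i)"
        using orthonormal_list_expansion[OF bs, of "v - p"] by (simp add: q_def)
      then show ?thesis by (simp add: inner_sum_right inner_diff_left)
    qed
    ultimately show ?thesis by (simp add: smooth_on_def)
  qed
  then have \<beta>_smooth: "smooth_on UNIV \<beta>"
    using smooth_on_compose[OF open_UNIV orthonormal_list_real _ \<psi>(1), of q]
    by (simp add: \<beta>_def[abs_def] o_def)
  have q: "q v = (dist p v)\<^sup>2" for v
    unfolding q_def power2_norm_eq_inner[symmetric] dist_norm by (simp add: norm_minus_commute)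
  define K where "K = chart_inv c ` cball p r"
  have cont: "continuous_map (top_of_set (snd c ` fst c)) (mtop M) (chart_inv c)"
    by (rule chart_inv_continuous_map[OF ch])
  have "compactin (top_of_set (snd c ` fst c)) (cball p r)"
    using r(2) compact_cball_orthonormal[OF bs, of p r] by (auto simp: compactin_subtopology)
  then have "compactin (mtop M) K"
    unfolding K_def by (rule image_compactin[OF _ cont])
  then have K_closed: "closedin (mtop M) K"
    using M compactin_imp_closedin unfolding smooth_manifold_def by blast
  have K_sub: "K \<subseteq> fst c \<inter> U"
    unfolding K_def using r(2) chart_inv_left[OF ch] by fastforce
  have K_mem: "y \<in> K" if "y \<in> fst c" "dist p (snd c y) \<le> r" for y
    unfolding K_def using that chart_inv_left[OF ch that(1)] by (metis imageI mem_cball)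
  \<comment> \<open>Within distance \<open>sqrt a\<close> of the centre the cutoff equals 1; the
    bound by \<open>r\<close> keeps \<open>V\<close> inside \<open>K\<close>, hence inside
    \<open>U\<close>.\<close>
  define s where "s = min r (sqrt a)"
  have s: "s > 0" "s \<le> r" "s \<le> sqrt a" using r(1) \<psi>(2) by (auto simp: s_def)
  define V where "V = {y \<in> fst c. snd c y \<in> ball p s}"
  have "openin (subtopology (mtop M) (fst c)) V"
  proof -
    have "{y \<in> topspace (subtopology (mtop M) (fst c)). snd c y \<in> ball p s} = V"
      using is_chart_subset[OF ch] by (auto simp: V_def)
    then show ?thesis
      using openin_continuous_map_preimage[OF chart_continuous_map[OF ch], of "ball p s"] by simp
  qed
  then have V: "openin (mtop M) V"
    using smooth_manifold_openin_chart[OF M c(1)] openin_trans_full by blast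
  define b where "b = (\<lambda>y\<in>points M. if y \<in> fst c then \<beta> (snd c y) else 0)"
  have b0: "b y = 0" if "y \<in> points M - K" for y
  proof (cases "y \<in> fst c")
    case True
    then have "r \<le> dist p (snd c y)" using K_mem[OF True] that by force
    then have "r\<^sup>2 \<le> q (snd c y)" unfolding q using r(1) by (simp add: power_mono)
    then show ?thesis using True that \<psi>(4) by (simp add: b_def \<beta>_def)
  qed (use that in \<open>simp add: b_def\<close>)
  have b1: "b y = 1" if "y \<in> V" for y
  proof -
    have "dist p (snd c y) \<le> sqrt a" using that s by (simp add: V_def)
    then have "q (snd c y) \<le> a" unfolding q using \<psi>(2)
      by (metis sqrt_ge_absD abs_of_nonneg zero_le_dist)
    then show ?thesis using that is_chart_subset[OF ch] \<psi>(3) by (auto simp: b_def \<beta>_def V_def)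
  qed
  have "smooth_fun_on M (points M) b"
  proof (rule smooth_fun_on_local[OF M])
    fix y assume y: "y \<in> points M"
    show "\<exists>V g. openin (mtop M) V \<and> y \<in> V \<and> smooth_fun_on M V g \<and> (\<forall>z\<in>V. g z = b z)"
    proof (cases "y \<in> fst c")
      case True
      then show ?thesis
        using smooth_fun_on_chart_compose[OF M c(1) \<beta>_smooth] is_chart_subset[OF ch]
          smooth_manifold_openin_chart[OF M c(1)]
        by (intro exI[of _ "fst c"] exI[of _ "\<lambda>x. \<beta> (snd c x)"]) (auto simp: b_def)
    next
      case False
      then show ?thesis
        using y K_sub b0 K_closed smooth_fun_on_const[of M _ 0]
        by (intro exI[of _ "points M - K"] exI[of _ "\<lambda>x. 0"]) auto
    qed
  qed
  then have "b \<in> carrier (smooth_functions M)"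
    by (simp add: smooth_functions_def b_def)
  moreover have "x \<in> V" using c(2) s(1) by (simp add: V_def p_def)
  moreover have "V \<subseteq> U" using K_mem K_sub s(2) by (force simp: V_def)
  ultimately show thesis using that V K_closed K_sub b0 b1 by blast
qed

text \<open>The product with a bump function is extended by zero; it agrees with \<open>g\<close>
  where the bump function is 1, and the complement of \<open>C\<close> covers the points outside
  \<open>U\<close>.\<close>

lemma smooth_functions_extend_germ:
  assumes M: "smooth_manifold M" and U: "openin (mtop M) U" "x \<in> U" and g: "smooth_fun_on M U g"
  obtains f V where "f \<in> carrier (smooth_functions M)" "openin (mtop M) V" "x \<in> V" "V \<subseteq> U"
    "\<And>y. y \<in> V \<Longrightarrow> f y = g y"
proof -
  obtain b V C where b: "b \<in> carrier (smooth_functions M)" "openin (mtop M) V" "x \<in> V" "V \<subseteq> U"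
    "closedin (mtop M) C" "C \<subseteq> U" "\<And>y. y \<in> V \<Longrightarrow> b y = 1" "\<And>y. y \<in> points M - C \<Longrightarrow> b y = 0"
    using smooth_functions_bump[OF M U] by blast
  define f where "f = (\<lambda>y\<in>points M. if y \<in> U then b y * g y else 0)"
  have Usub: "U \<subseteq> points M" using U(1) openin_subset by blast
  have bs: "smooth_fun_on M U b"
    using b(1) Usub smooth_fun_on_subset by (auto simp: smooth_functions_def)
  have "smooth_fun_on M (points M) f"
  proof (rule smooth_fun_on_local[OF M])
    fix y assume y: "y \<in> points M"
    show "\<exists>V g. openin (mtop M) V \<and> y \<in> V \<and> smooth_fun_on M V g \<and> (\<forall>z\<in>V. g z = f z)"
    proof (cases "y \<in> U")
      case True
      then show ?thesis
        using smooth_fun_on_mult[OF M U(1) bs g] U(1) Usub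
        by (intro exI[of _ U] exI[of _ "\<lambda>x. b x * g x"]) (auto simp: f_def)
    next
      case False
      then show ?thesis
        using y b smooth_fun_on_const[of M _ 0]
        by (intro exI[of _ "points M - C"] exI[of _ "\<lambda>x. 0"]) (auto simp: f_def)
    qed
  qed
  then have "f \<in> carrier (smooth_functions M)"
    by (simp add: smooth_functions_def f_def)
  moreover have "f y = g y" if "y \<in> V" for y
    using that b(4,7) Usub by (auto simp: f_def)
  ultimately show thesis using that b(2-4) by blast
qed

section \<open>Derivatives in charts\<close>

lemma smooth_functions_differentiable:
  assumes "smooth_manifold M" "f \<in> carrier (smooth_functions M)" "c \<in> charts M" "p \<in> fst c"
  shows "(f \<circ> chart_inv c) differentiable (at (snd c p))"
proof -
  have "smooth_on (snd c ` (fst c \<inter> points M)) (f \<circ> chart_inv c)"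
    using assms(2,3) by (simp add: smooth_functions_def smooth_fun_on_def)
  then show ?thesis
    by (rule smooth_on_imp_differentiable)
      (use assms(4) is_chart_subset[OF smooth_manifold_is_chart[OF assms(1,3)]] in auto)
qed

lemma chart_deriv_linear:
  assumes "smooth_manifold M" "f \<in> carrier (smooth_functions M)" "c \<in> charts M" "p \<in> fst c"
  shows "linear (\<lambda>v. chart_deriv c v f p)"
  using smooth_functions_differentiable[OF assms]
  unfolding chart_deriv_def frechet_derivative_works by (simp add: has_derivative_linear)

lemma chart_deriv_cong:
  assumes "smooth_manifold M" "c \<in> charts M" "p \<in> fst c" "openin (mtop M) V" "p \<in> V"
    and "\<And>y. y \<in> V \<Longrightarrow> f y = g y"
    and "(f \<circ> chart_inv c) differentiable (at (snd c p))"
  shows "chart_deriv c v f p = chart_deriv c v g p"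
proof -
  note ch = smooth_manifold_is_chart[OF assms(1,2)]
  have "(f \<circ> chart_inv c) z = (g \<circ> chart_inv c) z" if "z \<in> snd c ` (fst c \<inter> V)" for z
    using that chart_inv_left[OF ch] assms(6) by auto
  from differentiable_transform_open(2)[OF chart_open_image[OF ch assms(4)] _ this assms(7)]
  show ?thesis using assms(3,5) by (simp add: chart_deriv_def o_def)
qed

text \<open>Read in the chart, \<open>f\<close> is a linear functional near the point and so is its
  own derivative. In this way the action of a tangent vector on global functions reveals its
  components.\<close>

lemma chart_deriv_coordinate:
  assumes "smooth_manifold M" "c \<in> charts M" "p \<in> fst c" "openin (mtop M) V" "p \<in> V"
    and f: "f \<in> carrier (smooth_functions M)" "\<And>y. y \<in> V \<Longrightarrow> f y = snd c y \<bullet> w"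
  shows "chart_deriv c v f p = v \<bullet> w"
proof -
  note ch = smooth_manifold_is_chart[OF assms(1,2)]
  have D: "((\<lambda>z. z \<bullet> w) has_derivative (\<lambda>v. v \<bullet> w)) (at (snd c p))"
    by (simp add: bounded_linear_imp_has_derivative bounded_linear_inner_left)
  have "((f \<circ> chart_inv c) has_derivative (\<lambda>v. v \<bullet> w)) (at (snd c p))"
    by (rule has_derivative_transform_within_open[OF D chart_open_image[OF ch assms(4)]])
      (use assms(3,5) f(2) chart_inv_left[OF ch] in auto)
  from frechet_derivative_at[OF this, symmetric] show ?thesis
    by (simp add: chart_deriv_def)
qed

text \<open>This is the chain rule in charts: near the point, f \<circ> h read in d is f read in c
  after h read in d and c. The direction on the right is the coordinate form of the image of v under
  the tangent map of h.\<close>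

lemma chart_deriv_pushforward:
  assumes M: "smooth_manifold M" and N: "smooth_manifold N" and h: "smooth_map M N h"
    and d: "d \<in> charts M" "q \<in> fst d" and c: "c \<in> charts N" "h q \<in> fst c"
    and f: "f \<in> carrier (smooth_functions N)"
  shows "chart_deriv d v (f \<circ> h) q =
    chart_deriv c (frechet_derivative (snd c \<circ> h \<circ> chart_inv d) (at (snd d q)) v) f (h q)"
proof -
  note dch = smooth_manifold_is_chart[OF M d(1)] and cch = smooth_manifold_is_chart[OF N c(1)]
  let ?g = "snd c \<circ> h \<circ> chart_inv d"
  define W where "W = {x \<in> points M. h x \<in> fst c}"
  have W: "openin (mtop M) W"
    unfolding W_def using h smooth_manifold_openin_chart[OF N c(1)]
    by (auto simp: smooth_map_def intro: openin_continuous_map_preimage)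
  have q: "snd d q \<in> snd d ` (fst d \<inter> W)"
    using d(2) c(2) is_chart_subset[OF dch] by (auto simp: W_def)
  have "smooth_on (snd d ` (fst d \<inter> h -` fst c)) ?g"
    using h d(1) c(1) by (simp add: smooth_map_def)
  then have "?g differentiable (at (snd d q))"
    by (rule smooth_on_imp_differentiable) (use d(2) c(2) in auto)
  then have dg: "(?g has_derivative frechet_derivative ?g (at (snd d q))) (at (snd d q))"
    by (simp add: frechet_derivative_works)
  have gq: "?g (snd d q) = snd c (h q)" using chart_inv_left[OF dch d(2)] by simp
  have "(f \<circ> chart_inv c) differentiable (at (snd c (h q)))"
    by (rule smooth_functions_differentiable[OF N f c])
  then have df: "((f \<circ> chart_inv c) has_derivative frechet_derivative (f \<circ> chart_inv c) (at (snd c (h q))))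
      (at (?g (snd d q)))"
    unfolding gq by (simp add: frechet_derivative_works)
  have "((f \<circ> h \<circ> chart_inv d) has_derivative
      frechet_derivative (f \<circ> chart_inv c) (at (snd c (h q))) \<circ> frechet_derivative ?g (at (snd d q)))
      (at (snd d q))"
    by (rule has_derivative_transform_within_open[OF diff_chain_at[OF dg df]
          chart_open_image[OF dch W] q])
      (auto simp: W_def chart_inv_left[OF dch] chart_inv_left[OF cch])
  from frechet_derivative_at[OF this, symmetric] show ?thesis
    by (simp add: chart_deriv_def)
qed

lemma smooth_map_id: "smooth_manifold M \<Longrightarrow> smooth_map M M id"
  by (auto simp: smooth_map_def smooth_manifold_def compatible_charts_def)

section \<open>The fibres of the tangent bundle\<close>

lemma vbase_tangent_bundle [simp]: "vbase (tangent_bundle N) = N"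
  by (simp add: tangent_bundle_def)

text \<open>A change of charts is the push-forward along the identity; the witness is the image of v
  under the derivative of the transition map.\<close>

lemma tangent_vector_change_chart:
  assumes "smooth_manifold N" "c \<in> charts N" "x \<in> fst c" "d \<in> charts N" "x \<in> fst d"
  shows "\<exists>w. tangent_vector N d v x = tangent_vector N c w x"
proof -
  have "chart_deriv d v f x = chart_deriv c (frechet_derivative (snd c \<circ> id \<circ> chart_inv d) (at (snd d x)) v) f x"
    if "f \<in> carrier (smooth_functions N)" for f
    using chart_deriv_pushforward[OF assms(1,1) smooth_map_id[OF assms(1)] assms(4,5,2) _ that] assms(3)
    by simp
  then show ?thesis unfolding tangent_vector_def by (metis (no_types, lifting) restrict_ext)
qed

lemma carrier_tangent_fibre:
  assumes "smooth_manifold N" "c \<in> charts N" "x \<in> fst c"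
  shows "carrier (fibre (tangent_bundle N) x) = range (\<lambda>v. tangent_vector N c v x)"
proof -
  let ?T = "tangent_vector N"
  have proj: "fst (?T d v p) = p" for d v p by (simp add: tangent_vector_def)
  have "carrier (fibre (tangent_bundle N) x) = {?T d v x | d v. d \<in> charts N \<and> x \<in> fst d}"
  proof (rule Set.set_eqI)
    fix X
    have "X \<in> carrier (fibre (tangent_bundle N) x) \<longleftrightarrow>
        (\<exists>d v p. X = ?T d v p \<and> d \<in> charts N \<and> p \<in> fst d) \<and> fst X = x"
      by (simp add: fibre_def tangent_bundle_def del: split_paired_Ex)
    then show "X \<in> carrier (fibre (tangent_bundle N) x) \<longleftrightarrow>
        X \<in> {?T d v x | d v. d \<in> charts N \<and> x \<in> fst d}"
      unfolding mem_Collect_eq using proj by metis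
  qed
  also have "\<dots> = range (\<lambda>v. ?T c v x)"
    using tangent_vector_change_chart[OF assms] assms(2,3) by blast
  finally show ?thesis .
qed

lemma tangent_vector_add:
  assumes "smooth_manifold N" "c \<in> charts N" "x \<in> fst c"
  shows "tangent_vector N c v x \<oplus>\<^bsub>fibre (tangent_bundle N) x\<^esub> tangent_vector N c w x =
    tangent_vector N c (v + w) x"
  using linear_add[OF chart_deriv_linear[OF assms(1) _ assms(2,3)]]
  by (auto simp: tangent_vector_def fibre_def tangent_bundle_def intro!: restrict_ext)

lemma tangent_vector_scale:
  assumes "smooth_manifold N" "c \<in> charts N" "x \<in> fst c"
  shows "a \<odot>\<^bsub>fibre (tangent_bundle N) x\<^esub> tangent_vector N c v x = tangent_vector N c (a *\<^sub>R v) x"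
  using linear_cmul[OF chart_deriv_linear[OF assms(1) _ assms(2,3)]]
  by (auto simp: tangent_vector_def fibre_def tangent_bundle_def intro!: restrict_ext)

lemma tangent_vector_zero:
  assumes "smooth_manifold N" "c \<in> charts N" "x \<in> fst c"
  shows "\<zero>\<^bsub>fibre (tangent_bundle N) x\<^esub> = tangent_vector N c 0 x"
  using linear_0[OF chart_deriv_linear[OF assms(1) _ assms(2,3)]]
  by (auto simp: tangent_vector_def fibre_def tangent_bundle_def intro!: restrict_ext)

text \<open>\<open>lincomb\<close> is a \<open>finsum\<close> in the fibre, and its rules presuppose
  this structure. The laws are carried over from the model space by the surjective additive map that
  sends v to the vector with coordinates v.\<close>

lemma tangent_fibre_abelian_monoid:
  assumes "smooth_manifold N" "c \<in> charts N" "x \<in> fst c"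
  shows "abelian_monoid (fibre (tangent_bundle N) x)"
  by (rule abelian_monoidI)
    (auto simp: carrier_tangent_fibre[OF assms] tangent_vector_add[OF assms]
      tangent_vector_zero[OF assms] add_ac)

lemma tangent_lincomb:
  assumes "smooth_manifold N" "c \<in> charts N" "x \<in> fst c"
  shows "lincomb (tangent_bundle N) k (\<lambda>i. tangent_vector N c (e i)) a x =
    tangent_vector N c (\<Sum>i<k. a i *\<^sub>R e i) x"
proof -
  interpret abelian_monoid "fibre (tangent_bundle N) x"
    by (rule tangent_fibre_abelian_monoid[OF assms])
  have "(\<Oplus>\<^bsub>fibre (tangent_bundle N) x\<^esub>i\<in>I. a i \<odot>\<^bsub>fibre (tangent_bundle N) x\<^esub> tangent_vector N c (e i) x) =
    tangent_vector N c (\<Sum>i\<in>I. a i *\<^sub>R e i) x" if "finite I" for I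
    using that
  proof (induction I)
    case empty
    then show ?case by (simp add: tangent_vector_zero[OF assms])
  next
    case (insert i I)
    have "(\<lambda>i. a i \<odot>\<^bsub>fibre (tangent_bundle N) x\<^esub> tangent_vector N c (e i) x) \<in>
      I \<rightarrow> carrier (fibre (tangent_bundle N) x)" for I
      by (auto simp: tangent_vector_scale[OF assms] carrier_tangent_fibre[OF assms])
    then show ?case
      using insert by (simp add: finsum_insert tangent_vector_add[OF assms] tangent_vector_scale[OF assms]
          carrier_tangent_fibre[OF assms])
  qed
  then show ?thesis by (simp add: lincomb_def)
qed

lemma smooth_functions_coordinate:
  assumes "smooth_manifold N" "c \<in> charts N" "x \<in> fst c"
  obtains f V where "f \<in> carrier (smooth_functions N)" "openin (mtop N) V" "x \<in> V" "V \<subseteq> fst c"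
    "\<And>y. y \<in> V \<Longrightarrow> f y = snd c y \<bullet> e"
proof -
  have "smooth_on UNIV (\<lambda>z. z \<bullet> e)"
    by (simp add: smooth_on_def Ck_on_bounded_linear bounded_linear_inner_left)
  from smooth_fun_on_chart_compose[OF assms(1,2) this]
  show thesis
    by (rule smooth_functions_extend_germ[OF assms(1) smooth_manifold_openin_chart[OF assms(1,2)] assms(3)])
      (rule that)
qed

text \<open>Equal vectors act equally on global functions that coincide near x with the coordinate
  in direction e; these actions are the inner products of v and w with e.\<close>

lemma tangent_vector_inj:
  assumes N: "smooth_manifold N" "c \<in> charts N" "x \<in> fst c" and eq: "tangent_vector N c v x = tangent_vector N c w x"
  shows "v = w"
proof -
  have "v \<bullet> e = w \<bullet> e" for e
  proof -
    obtain f V where f: "f \<in> carrier (smooth_functions N)" "openin (mtop N) V" "x \<in> V"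
      "\<And>y. y \<in> V \<Longrightarrow> f y = snd c y \<bullet> e"
      by (rule smooth_functions_coordinate[OF N, of e]) (rule that)
    have "snd (tangent_vector N c v x) f = snd (tangent_vector N c w x) f" by (simp add: eq)
    then show ?thesis
      using chart_deriv_coordinate[OF N f(2,3,1,4)] f(1) by (simp add: tangent_vector_def)
  qed
  then have "\<forall>e. v \<bullet> e = w \<bullet> e" by blast
  then show ?thesis by (simp only: vector_eq_rdot)
qed

text \<open>\<open>frame_coord\<close> is a definite description, so both existence and uniqueness
  of the coefficients matter. Existence is the orthonormal expansion of v; for uniqueness the
  expansion is paired with each basis vector, while extensionality fixes the values at indices from
  \<open>length bs\<close> on.\<close>

lemma frame_coord_tangent_vector:
  assumes N: "smooth_manifold N" "c \<in> charts N" "x \<in> fst c" and bs: "orthonormal_list bs"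
    and i: "i < length bs"
  shows "frame_coord (tangent_bundle N) (coord_frame N bs c) (tangent_vector N c v x) i = v \<bullet> bs ! i"
proof -
  let ?P = "\<lambda>a. a \<in> {..<length bs} \<rightarrow>\<^sub>E UNIV \<and> tangent_vector N c v x =
    lincomb (tangent_bundle N) (length bs) (\<lambda>i. tangent_vector N c (bs ! i)) a x"
  have unique: "a i = v \<bullet> bs ! i" if "?P a" "i < length bs" for a i
  proof -
    have "v = (\<Sum>j<length bs. a j *\<^sub>R bs ! j)"
      using that(1) tangent_vector_inj[OF N] by (simp add: tangent_lincomb[OF N])
    then have "v \<bullet> bs ! i = (\<Sum>j<length bs. a j * (bs ! j \<bullet> bs ! i))"
      by (simp add: inner_sum_left)
    also have "\<dots> = (\<Sum>j<length bs. if j = i then a j else 0)"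
      using bs that(2) by (intro sum.cong) (auto simp: orthonormal_list_def)
    finally show ?thesis using that(2) by simp
  qed
  have "?P (\<lambda>i\<in>{..<length bs}. v \<bullet> bs ! i)"
    by (simp add: tangent_lincomb[OF N] orthonormal_list_expansion[OF bs])
  moreover have "a = (\<lambda>i\<in>{..<length bs}. v \<bullet> bs ! i)" if "?P a" for a
    using that unique[OF that] by (intro ext) (auto simp: PiE_def extensional_def)
  ultimately have "(THE a. ?P a) = (\<lambda>i\<in>{..<length bs}. v \<bullet> bs ! i)"
    by (intro the_equality)
  moreover have "vproj (tangent_bundle N) (tangent_vector N c v x) = x"
    by (simp add: tangent_bundle_def tangent_vector_def)
  ultimately show ?thesis
    using i by (simp add: frame_coord_def coord_frame_def)
qed

text \<open>One and the same \<open>f\<close> serves all points of \<open>V\<close>, so the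
  component of a whole family of vectors becomes their action on a single global function. This is
  what turns smoothness of the components of a bundle map into smoothness of the anchor applied to
  one function.\<close>

lemma frame_coord_tangent_eq_action:
  assumes N: "smooth_manifold N" "c \<in> charts N" "x \<in> fst c" and bs: "orthonormal_list bs"
    and i: "i < length bs" and X: "X \<in> carrier (fibre (tangent_bundle N) x)"
    and f: "f \<in> carrier (smooth_functions N)" "openin (mtop N) V" "x \<in> V"
      "\<And>y. y \<in> V \<Longrightarrow> f y = snd c y \<bullet> bs ! i"
  shows "frame_coord (tangent_bundle N) (coord_frame N bs c) X i = snd X f"
proof -
  obtain v where v: "X = tangent_vector N c v x" using X carrier_tangent_fibre[OF N] by auto
  have "chart_deriv c v f x = v \<bullet> bs ! i"
    using chart_deriv_coordinate[OF N f(2,3,1,4)] by blast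
  then show ?thesis
    using frame_coord_tangent_vector[OF N bs i, of v] f(1) by (simp add: v tangent_vector_def)
qed

text \<open>The sum has the shape of the anchor formula at a point. By the chain rule each summand
  is the action of a vector at h q, and the derivative in a chart around h q is linear in the
  direction, so arbitrary numbers \<open>r j\<close> are allowed.\<close>

lemma pushforward_tangent_fibre:
  assumes M: "smooth_manifold M" and N: "smooth_manifold N" and h: "smooth_map M N h"
    and d: "d \<in> charts M" "q \<in> fst d"
  shows "(h q, \<lambda>f\<in>carrier (smooth_functions N). \<Sum>j\<in>J. r j * chart_deriv d (e j) (f \<circ> h) q) \<in>
    carrier (fibre (tangent_bundle N) (h q))"
proof -
  have "q \<in> points M" using d is_chart_subset[OF smooth_manifold_is_chart[OF M d(1)]] by auto
  then have "h q \<in> points N"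
    using h by (auto simp: smooth_map_def continuous_map_def)
  then obtain c where c: "c \<in> charts N" "h q \<in> fst c"
    using smooth_manifold_obtain_chart[OF N] by blast
  let ?D = "frechet_derivative (snd c \<circ> h \<circ> chart_inv d) (at (snd d q))"
  have "(\<Sum>j\<in>J. r j * chart_deriv d (e j) (f \<circ> h) q) =
      chart_deriv c (\<Sum>j\<in>J. r j *\<^sub>R ?D (e j)) f (h q)"
    if f: "f \<in> carrier (smooth_functions N)" for f
  proof -
    note lin = chart_deriv_linear[OF N f c]
    show ?thesis
      by (simp add: chart_deriv_pushforward[OF M N h d c f] linear_sum[OF lin] linear_cmul[OF lin])
  qed
  then have "(h q, \<lambda>f\<in>carrier (smooth_functions N). \<Sum>j\<in>J. r j * chart_deriv d (e j) (f \<circ> h) q) =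
      tangent_vector N c (\<Sum>j\<in>J. r j *\<^sub>R ?D (e j)) (h q)"
    unfolding tangent_vector_def by (auto intro!: restrict_ext)
  then show ?thesis using carrier_tangent_fibre[OF N c] by auto
qed

section \<open>Sections of vector bundles\<close>

lemma frame_coord_unique:
  assumes "is_frame F (k, U, t)" "x \<in> U" "v \<in> carrier (fibre F x)"
  shows "frame_coord F (k, U, t) v \<in> {..<k} \<rightarrow>\<^sub>E UNIV"
    and "v = lincomb F k t (frame_coord F (k, U, t) v) x"
    and "a \<in> {..<k} \<rightarrow>\<^sub>E UNIV \<Longrightarrow> v = lincomb F k t a x \<Longrightarrow> frame_coord F (k, U, t) v = a"
proof -
  have ex: "\<exists>!a. a \<in> {..<k} \<rightarrow>\<^sub>E UNIV \<and> v = lincomb F k t a x"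
    using assms by (simp add: is_frame_def)
  have eq: "frame_coord F (k, U, t) v = (THE a. a \<in> {..<k} \<rightarrow>\<^sub>E UNIV \<and> v = lincomb F k t a x)"
    using assms(3) by (simp add: frame_coord_def fibre_def)
  show "frame_coord F (k, U, t) v \<in> {..<k} \<rightarrow>\<^sub>E UNIV" "v = lincomb F k t (frame_coord F (k, U, t) v) x"
    using theI'[OF ex] eq by auto
  show "frame_coord F (k, U, t) v = a" if "a \<in> {..<k} \<rightarrow>\<^sub>E UNIV" "v = lincomb F k t a x"
    unfolding eq by (rule the1_equality[OF ex]) (use that in blast)
qed

lemma vector_bundle_fibre_module:
  "vector_bundle F \<Longrightarrow> x \<in> points (vbase F) \<Longrightarrow> Module.module real_ring (fibre F x)"
  by (simp add: vector_bundle_def)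

lemma vector_bundle_vframe:
  assumes "vector_bundle F" "(k, U, t) \<in> vframes F"
  shows "is_frame F (k, U, t)" "openin (mtop (vbase F)) U" "U \<subseteq> points (vbase F)"
    "\<And>\<alpha>. \<alpha> < k \<Longrightarrow> smooth_local_section F U (t \<alpha>)"
proof -
  have "local_base F (k, U, t)" using assms by (auto simp: vector_bundle_def)
  then show "is_frame F (k, U, t)" "\<And>\<alpha>. \<alpha> < k \<Longrightarrow> smooth_local_section F U (t \<alpha>)"
    by (auto simp: local_base_def)
  then show "openin (mtop (vbase F)) U" "U \<subseteq> points (vbase F)"
    using openin_subset by (auto simp: is_frame_def)
qed

text \<open>The multiples by r of the coefficients of v represent r times v, and coefficients are
  unique. This is needed to see the products of a section with a bump function in a second
  frame.\<close>

lemma frame_coord_scale: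
  assumes F: "Module.module real_ring (fibre F x)" and fr: "is_frame F (k, U, t)"
    and x: "x \<in> U" and v: "v \<in> carrier (fibre F x)" and \<alpha>: "\<alpha> < k"
  shows "frame_coord F (k, U, t) (r \<odot>\<^bsub>fibre F x\<^esub> v) \<alpha> = r * frame_coord F (k, U, t) v \<alpha>"
proof -
  interpret Module.module real_ring "fibre F x" by (rule F)
  let ?a = "frame_coord F (k, U, t) v"
  let ?b = "\<lambda>\<alpha>\<in>{..<k}. r * ?a \<alpha>"
  have t: "t \<beta> x \<in> carrier (fibre F x)" if "\<beta> < k" for \<beta>
    using fr x that by (simp add: is_frame_def)
  have car: "s \<in> carrier real_ring" for s by (simp add: real_ring_def)
  have "r \<odot>\<^bsub>fibre F x\<^esub> v = r \<odot>\<^bsub>fibre F x\<^esub> lincomb F k t ?a x"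
    using frame_coord_unique(2)[OF fr x v] by simp
  also have "\<dots> = (\<Oplus>\<^bsub>fibre F x\<^esub>\<alpha>\<in>{..<k}. r \<odot>\<^bsub>fibre F x\<^esub> (?a \<alpha> \<odot>\<^bsub>fibre F x\<^esub> t \<alpha> x))"
    unfolding lincomb_def by (rule finsum_smult_ldistr) (auto simp: t car)
  also have "\<dots> = lincomb F k t ?b x"
    unfolding lincomb_def
  proof (rule finsum_cong')
    show "r \<odot>\<^bsub>fibre F x\<^esub> (?a \<beta> \<odot>\<^bsub>fibre F x\<^esub> t \<beta> x) = ?b \<beta> \<odot>\<^bsub>fibre F x\<^esub> t \<beta> x" if "\<beta> \<in> {..<k}" for \<beta>
      using smult_assoc1[OF car car t, of \<beta> r "?a \<beta>"] that by (simp add: real_ring_def)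
  qed (auto simp: t car)
  finally have "frame_coord F (k, U, t) (r \<odot>\<^bsub>fibre F x\<^esub> v) = ?b"
    using frame_coord_unique(3)[OF fr x smult_closed[OF car v], of ?b] by simp
  then show ?thesis using \<alpha> by simp
qed

text \<open>The frame section is multiplied by a bump function and continued by the zero vector. Its
  smoothness is tested in every bundle chart: over \<open>U\<close> its coordinates are those of
  \<open>t \<alpha>\<close> times the bump function, and off \<open>C\<close> they vanish.\<close>

lemma frame_section_extend:
  assumes F: "vector_bundle F" and fr: "(k, U, t) \<in> vframes F" and \<alpha>: "\<alpha> < k" and x: "x \<in> U"
  obtains u V where "u \<in> carrier (sections F)" "openin (mtop (vbase F)) V" "x \<in> V" "V \<subseteq> U"
    "\<And>y. y \<in> V \<Longrightarrow> u y = t \<alpha> y"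
proof -
  let ?N = "vbase F"
  have N: "smooth_manifold ?N" using F by (simp add: vector_bundle_def)
  note U = vector_bundle_vframe[OF F fr]
  obtain b V C where b: "b \<in> carrier (smooth_functions ?N)" "openin (mtop ?N) V" "x \<in> V" "V \<subseteq> U"
    "closedin (mtop ?N) C" "C \<subseteq> U" "\<And>y. y \<in> V \<Longrightarrow> b y = 1" "\<And>y. y \<in> points ?N - C \<Longrightarrow> b y = 0"
    using smooth_functions_bump[OF N U(2) x] by blast
  define u where "u = (\<lambda>y\<in>points ?N. if y \<in> U then b y \<odot>\<^bsub>fibre F y\<^esub> t \<alpha> y else \<zero>\<^bsub>fibre F y\<^esub>)"
  have car: "s \<in> carrier real_ring" for s by (simp add: real_ring_def)
  have t: "t \<alpha> y \<in> carrier (fibre F y)" if "y \<in> U" for y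
    using U(1) \<alpha> that by (simp add: is_frame_def)
  have u_mem: "u y \<in> carrier (fibre F y)" if "y \<in> points ?N" for y
  proof -
    interpret Module.module real_ring "fibre F y" by (rule vector_bundle_fibre_module[OF F that])
    show ?thesis using that t[of y] by (simp add: u_def car)
  qed
  \<comment> \<open>Off \<open>C\<close> the section vanishes for two reasons: inside
    \<open>U\<close> the bump function is 0, outside \<open>U\<close> the zero vector was chosen.
    Stated as 0 times \<open>u y\<close>, this lets \<open>frame_coord_scale\<close> show that all
    coordinates are 0.\<close>
  have u_zero: "u y = 0 \<odot>\<^bsub>fibre F y\<^esub> u y" if y: "y \<in> points ?N - C" for y
  proof -
    interpret Module.module real_ring "fibre F y" by (rule vector_bundle_fibre_module[OF F]) (use y in blast)
    have zero: "0 \<odot>\<^bsub>fibre F y\<^esub> v = \<zero>\<^bsub>fibre F y\<^esub>" if "v \<in> carrier (fibre F y)" for v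
      using smult_l_null[OF that] by (simp add: real_ring_def)
    then have "u y = \<zero>\<^bsub>fibre F y\<^esub>" using y t[of y] b(8)[OF y] by (simp add: u_def)
    then show ?thesis using zero[of "u y"] u_mem[of y] y by simp
  qed
  have "smooth_fun_on ?N (U' \<inter> points ?N) (\<lambda>y. frame_coord F (k', U', t') (u y) \<beta>)"
    if fr': "(k', U', t') \<in> vframes F" and \<beta>: "\<beta> < k'" for k' U' t' \<beta>
  proof (rule smooth_fun_on_local[OF N])
    note U' = vector_bundle_vframe[OF F fr']
    fix y assume y: "y \<in> U' \<inter> points ?N"
    show "\<exists>V g. openin (mtop ?N) V \<and> y \<in> V \<and> smooth_fun_on ?N V g \<and>
      (\<forall>z\<in>V. g z = frame_coord F (k', U', t') (u z) \<beta>)"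
    proof (cases "y \<in> U")
      case True
      have op: "openin (mtop ?N) (U' \<inter> U)" using U(2) U'(2) by blast
      have "smooth_fun_on ?N (U' \<inter> U) (\<lambda>z. frame_coord F (k', U', t') (t \<alpha> z) \<beta>)"
        using U(4)[OF \<alpha>] fr' \<beta> by (auto simp: smooth_local_section_def)
      moreover have "smooth_fun_on ?N (U' \<inter> U) b"
        using b(1) U(3) smooth_fun_on_subset[of "U' \<inter> U" "points ?N"] by (auto simp: smooth_functions_def)
      ultimately have "smooth_fun_on ?N (U' \<inter> U) (\<lambda>z. b z * frame_coord F (k', U', t') (t \<alpha> z) \<beta>)"
        using smooth_fun_on_mult[OF N op] by blast
      moreover have "b z * frame_coord F (k', U', t') (t \<alpha> z) \<beta> = frame_coord F (k', U', t') (u z) \<beta>"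
        if z: "z \<in> U' \<inter> U" for z
        using frame_coord_scale[OF vector_bundle_fibre_module[OF F] U'(1) _ t \<beta>, of z "b z"] z U(3)
        by (auto simp: u_def)
      ultimately show ?thesis using op True y by blast
    next
      case False
      have "0 = frame_coord F (k', U', t') (u z) \<beta>" if z: "z \<in> U' \<inter> (points ?N - C)" for z
        using frame_coord_scale[OF vector_bundle_fibre_module[OF F] U'(1) _ u_mem \<beta>, of z 0] z u_zero[of z]
        by auto
      moreover have "openin (mtop ?N) (U' \<inter> (points ?N - C))"
        using U'(2) b(5) by blast
      ultimately show ?thesis
        using y False b(6) smooth_fun_on_const[of ?N "U' \<inter> (points ?N - C)" 0]
        by (intro exI[of _ "U' \<inter> (points ?N - C)"] exI[of _ "\<lambda>x. 0"]) blast
    qed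
  qed
  then have "u \<in> carrier (sections F)"
    using u_mem by (auto simp: sections_def smooth_local_section_def u_def)
  moreover have "u y = t \<alpha> y" if "y \<in> V" for y
  proof -
    have y: "y \<in> U" "y \<in> points ?N" using that b(4) U(3) by auto
    interpret Module.module real_ring "fibre F y" by (rule vector_bundle_fibre_module[OF F y(2)])
    show ?thesis using y b(7)[OF that] smult_one[OF t[OF y(1)]] by (simp add: u_def real_ring_def)
  qed
  ultimately show thesis using that b(2-4) by blast
qed

lemma smooth_functions_const: "(\<lambda>x\<in>points N. a) \<in> carrier (smooth_functions N)"
  if "smooth_manifold N"
proof -
  have "smooth_fun_on N (points N) (\<lambda>x\<in>points N. a)"
    by (rule smooth_fun_on_cong[OF that openin_topspace _ smooth_fun_on_const[of N _ a]]) auto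
  then show ?thesis by (simp add: smooth_functions_def)
qed

text \<open>The frame expansion of v at x is imitated by global sections: each frame member is
  extended, and its coefficient becomes a constant function. The hypothesis \<open>sec\<close>
  supplies closure of sections under sums and multiples; the induction over \<open>I\<close> builds
  the sum one summand at a time.\<close>

lemma section_through_vector:
  assumes F: "vector_bundle F" and sec: "Module.module (smooth_functions (vbase F)) (sections F)"
    and x: "x \<in> points (vbase F)" and v: "v \<in> carrier (fibre F x)"
  obtains u where "u \<in> carrier (sections F)" "u x = v"
proof -
  let ?N = "vbase F"
  have N: "smooth_manifold ?N" using F by (simp add: vector_bundle_def)
  interpret S: Module.module "smooth_functions ?N" "sections F" by (rule sec)
  interpret Module.module real_ring "fibre F x" by (rule vector_bundle_fibre_module[OF F x])
  have "x \<in> (\<Union>(k, U, t)\<in>vframes F. U)" using F x by (simp add: vector_bundle_def)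
  then obtain k U t where fr: "(k, U, t) \<in> vframes F" and xU: "x \<in> U" by auto
  note U = vector_bundle_vframe[OF F fr]
  have car: "s \<in> carrier real_ring" for s by (simp add: real_ring_def)
  have t: "t \<alpha> x \<in> carrier (fibre F x)" if "\<alpha> < k" for \<alpha>
    using U(1) xU that by (simp add: is_frame_def)
  let ?a = "frame_coord F (k, U, t) v"
  have "\<exists>u\<in>carrier (sections F). u x = (\<Oplus>\<^bsub>fibre F x\<^esub>\<alpha>\<in>I. ?a \<alpha> \<odot>\<^bsub>fibre F x\<^esub> t \<alpha> x)"
    if "finite I" "I \<subseteq> {..<k}" for I
    using that
  proof (induction I)
    case empty
    have "\<zero>\<^bsub>sections F\<^esub> x = \<zero>\<^bsub>fibre F x\<^esub>" using x by (simp add: sections_def fibre_def)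
    then show ?case using S.zero_closed by (auto intro: bexI[of _ "\<zero>\<^bsub>sections F\<^esub>"])
  next
    case (insert \<alpha> I)
    then obtain u where u: "u \<in> carrier (sections F)"
      "u x = (\<Oplus>\<^bsub>fibre F x\<^esub>\<alpha>\<in>I. ?a \<alpha> \<odot>\<^bsub>fibre F x\<^esub> t \<alpha> x)" by auto
    have "\<alpha> < k" using insert.prems by simp
    from frame_section_extend[OF F fr this xU]
    obtain w where w: "w \<in> carrier (sections F)" "w x = t \<alpha> x" by metis
    let ?c = "\<lambda>y\<in>points ?N. ?a \<alpha>"
    let ?u = "(?c \<odot>\<^bsub>sections F\<^esub> w) \<oplus>\<^bsub>sections F\<^esub> u"
    have "?u \<in> carrier (sections F)"
      using u(1) w(1) smooth_functions_const[OF N] by blast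
    moreover have "?u x = (?a \<alpha> \<odot>\<^bsub>fibre F x\<^esub> t \<alpha> x) \<oplus>\<^bsub>fibre F x\<^esub> u x"
      using x w(2) by (simp add: sections_def fibre_def)
    moreover have "(\<Oplus>\<^bsub>fibre F x\<^esub>\<alpha>\<in>insert \<alpha> I. ?a \<alpha> \<odot>\<^bsub>fibre F x\<^esub> t \<alpha> x) =
        (?a \<alpha> \<odot>\<^bsub>fibre F x\<^esub> t \<alpha> x) \<oplus>\<^bsub>fibre F x\<^esub> u x"
      unfolding u(2) using insert by (intro finsum_insert) (auto simp: t car)
    ultimately show ?case by (intro bexI[of _ ?u]) simp_all
  qed
  from this[of "{..<k}"] show thesis
    using that frame_coord_unique(2)[OF U(1) xU v] by (auto simp: lincomb_def)
qed

section \<open>The anchor of a generalized Lie algebra\<close>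

lemma module_derivation_closed:
  "\<rho> \<in> module_morphisms R A (Der R) \<Longrightarrow> u \<in> carrier A \<Longrightarrow> f \<in> carrier R \<Longrightarrow> \<rho> u f \<in> carrier R"
  by (auto simp: module_morphisms_def Der_def)

text \<open>Polarization: expand the vanishing bracket of u \<oplus> v with itself.\<close>

lemma lie_prealgebra_antisym:
  fixes A (structure)
  assumes L: "lie_prealgebra R A br" and u: "u \<in> carrier A" and v: "v \<in> carrier A"
  shows "br v u = \<ominus> br u v"
proof -
  interpret Module.module R A using L by (simp add: lie_prealgebra_def)
  have closed: "br x y \<in> carrier A" if "x \<in> carrier A" "y \<in> carrier A" for x y
    using L that by (auto simp: lie_prealgebra_def)
  have self: "br x x = \<zero>" if "x \<in> carrier A" for x using L that by (simp add: lie_prealgebra_def)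
  have add: "br (x \<oplus> y) z = br x z \<oplus> br y z" "br z (x \<oplus> y) = br z x \<oplus> br z y"
    if "x \<in> carrier A" "y \<in> carrier A" "z \<in> carrier A" for x y z
    using L that unfolding lie_prealgebra_def by blast+
  have "\<zero> = br (u \<oplus> v) (u \<oplus> v)" using self u v by simp
  also have "\<dots> = (br u u \<oplus> br v u) \<oplus> (br u v \<oplus> br v v)"
    using u v by (simp only: add M.a_closed)
  also have "\<dots> = br u v \<oplus> br v u"
    using u v closed by (simp add: self M.a_comm)
  finally show ?thesis
    using u v closed by (metis M.add.m_comm M.minus_equality)
qed

text \<open>After expansion by the Leibniz rule, the terms with f undifferentiated form f times the
  Jacobi identity for u, v, w, and the terms with one derivative of f occur twice with opposite
  signs. What remains is the curvature of the anchor acting on w. Over a general ring this does not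
  yet say that the curvature is zero, since a module may have nonzero annihilators.\<close>

lemma generalized_lie_algebra_curvature_annihilates:
  fixes R (structure)
  assumes G: "generalized_lie_algebra R A br \<rho>"
    and u: "u \<in> carrier A" and v: "v \<in> carrier A" and w: "w \<in> carrier A" and f: "f \<in> carrier R"
  shows "(der_commutator R (\<rho> u) (\<rho> v) f \<ominus> \<rho> (br u v) f) \<odot>\<^bsub>A\<^esub> w = \<zero>\<^bsub>A\<^esub>"
proof -
  have L: "lie_prealgebra R A br" and \<rho>: "\<rho> \<in> module_morphisms R A (Der R)"
    using G by (auto simp: generalized_lie_algebra_def)
  interpret Module.module R A using L by (simp add: lie_prealgebra_def)
  note anti = lie_prealgebra_antisym[OF L]
  have br_closed: "br x y \<in> carrier A" if "x \<in> carrier A" "y \<in> carrier A" for x y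
    using L that by (auto simp: lie_prealgebra_def)
  note r_closed = module_derivation_closed[OF \<rho>]
  note closed = u v w f br_closed r_closed
  have add: "br z (x \<oplus>\<^bsub>A\<^esub> y) = br z x \<oplus>\<^bsub>A\<^esub> br z y"
    if "x \<in> carrier A" "y \<in> carrier A" "z \<in> carrier A" for x y z
    using L that unfolding lie_prealgebra_def by blast
  have jacobi: "br x (br y z) \<oplus>\<^bsub>A\<^esub> br z (br x y) \<oplus>\<^bsub>A\<^esub> br y (br z x) = \<zero>\<^bsub>A\<^esub>"
    if "x \<in> carrier A" "y \<in> carrier A" "z \<in> carrier A" for x y z
    using L that unfolding lie_prealgebra_def by blast
  have leibniz: "br x (g \<odot>\<^bsub>A\<^esub> y) = (g \<odot>\<^bsub>A\<^esub> br x y) \<oplus>\<^bsub>A\<^esub> (\<rho> x g \<odot>\<^bsub>A\<^esub> y)"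
    if "x \<in> carrier A" "y \<in> carrier A" "g \<in> carrier R" for x y g
    using G that by (simp add: generalized_lie_algebra_def)
  \<comment> \<open>In \<open>p\<close>, \<open>p'\<close>, \<open>p''\<close> the function f is not
    differentiated, \<open>q\<close> and \<open>s\<close> contain one derivative of f, and
    \<open>k\<close>, \<open>l\<close>, \<open>m\<close> are the three curvature terms.\<close>
  define p where "p = f \<odot>\<^bsub>A\<^esub> br u (br v w)"
  define p' where "p' = f \<odot>\<^bsub>A\<^esub> br (br u v) w"
  define p'' where "p'' = f \<odot>\<^bsub>A\<^esub> br v (br u w)"
  define q where "q = \<rho> u f \<odot>\<^bsub>A\<^esub> br v w"
  define s where "s = \<rho> v f \<odot>\<^bsub>A\<^esub> br u w"
  define k where "k = \<rho> u (\<rho> v f) \<odot>\<^bsub>A\<^esub> w"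
  define l where "l = \<rho> v (\<rho> u f) \<odot>\<^bsub>A\<^esub> w"
  define m where "m = \<rho> (br u v) f \<odot>\<^bsub>A\<^esub> w"
  note defs = p_def p'_def p''_def q_def s_def k_def l_def m_def
  have car: "p \<in> carrier A" "p' \<in> carrier A" "p'' \<in> carrier A" "q \<in> carrier A" "s \<in> carrier A"
    "k \<in> carrier A" "l \<in> carrier A" "m \<in> carrier A"
    by (simp_all add: defs closed)
  have 1: "br u (br v (f \<odot>\<^bsub>A\<^esub> w)) = (p \<oplus>\<^bsub>A\<^esub> q) \<oplus>\<^bsub>A\<^esub> (s \<oplus>\<^bsub>A\<^esub> k)"
    by (simp add: leibniz add closed defs)
  \<comment> \<open>The Leibniz rule concerns the second argument, so antisymmetry first moves f
    \<odot> w there.\<close>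
  have 2: "br (f \<odot>\<^bsub>A\<^esub> w) (br u v) = \<ominus>\<^bsub>A\<^esub> (p' \<oplus>\<^bsub>A\<^esub> m)"
    by (subst anti[of "br u v" "f \<odot>\<^bsub>A\<^esub> w"]) (simp_all add: leibniz closed defs)
  have neg: "br x (\<ominus>\<^bsub>A\<^esub> y) = \<ominus>\<^bsub>A\<^esub> br x y" if xy: "x \<in> carrier A" "y \<in> carrier A" for x y
  proof -
    have "br x \<zero>\<^bsub>A\<^esub> = br x \<zero>\<^bsub>A\<^esub> \<oplus>\<^bsub>A\<^esub> br x \<zero>\<^bsub>A\<^esub>" using add[of "\<zero>\<^bsub>A\<^esub>" "\<zero>\<^bsub>A\<^esub>" x] xy by simp
    then have "br x \<zero>\<^bsub>A\<^esub> = \<zero>\<^bsub>A\<^esub>" using xy br_closed M.add.r_cancel_one' by (metis M.zero_closed)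
    moreover have "br x (y \<oplus>\<^bsub>A\<^esub> \<ominus>\<^bsub>A\<^esub> y) = br x y \<oplus>\<^bsub>A\<^esub> br x (\<ominus>\<^bsub>A\<^esub> y)" using add xy by simp
    ultimately have "br x y \<oplus>\<^bsub>A\<^esub> br x (\<ominus>\<^bsub>A\<^esub> y) = \<zero>\<^bsub>A\<^esub>" using xy M.r_neg by simp
    then show ?thesis using xy br_closed M.minus_equality M.add.m_comm
      by (metis M.a_inv_closed)
  qed
  have 3: "br v (br (f \<odot>\<^bsub>A\<^esub> w) u) = \<ominus>\<^bsub>A\<^esub> ((p'' \<oplus>\<^bsub>A\<^esub> s) \<oplus>\<^bsub>A\<^esub> (q \<oplus>\<^bsub>A\<^esub> l))"
    by (subst anti[of u "f \<odot>\<^bsub>A\<^esub> w"]) (simp_all add: neg leibniz add closed defs)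
  have "p \<oplus>\<^bsub>A\<^esub> \<ominus>\<^bsub>A\<^esub> p' \<oplus>\<^bsub>A\<^esub> \<ominus>\<^bsub>A\<^esub> p'' = f \<odot>\<^bsub>A\<^esub> (br u (br v w) \<oplus>\<^bsub>A\<^esub> \<ominus>\<^bsub>A\<^esub> br (br u v) w \<oplus>\<^bsub>A\<^esub> \<ominus>\<^bsub>A\<^esub> br v (br u w))"
    by (simp add: defs smult_r_distr smult_r_minus closed)
  also have "br u (br v w) \<oplus>\<^bsub>A\<^esub> \<ominus>\<^bsub>A\<^esub> br (br u v) w \<oplus>\<^bsub>A\<^esub> \<ominus>\<^bsub>A\<^esub> br v (br u w) = \<zero>\<^bsub>A\<^esub>"
    using jacobi[OF u v w] anti[of "br u v" w] anti[of u w] by (simp add: neg closed)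
  finally have 4: "p \<oplus>\<^bsub>A\<^esub> \<ominus>\<^bsub>A\<^esub> p' \<oplus>\<^bsub>A\<^esub> \<ominus>\<^bsub>A\<^esub> p'' = \<zero>\<^bsub>A\<^esub>" by (simp add: f)
  \<comment> \<open>The final calculation runs from the curvature back to the Jacobi sum. This
    identity restores the terms \<open>q\<close> and \<open>s\<close>, which have to be added and
    subtracted on the way.\<close>
  have cancel: "(y \<oplus>\<^bsub>A\<^esub> b) \<oplus>\<^bsub>A\<^esub> c \<oplus>\<^bsub>A\<^esub> (\<ominus>\<^bsub>A\<^esub> y \<oplus>\<^bsub>A\<^esub> d) = b \<oplus>\<^bsub>A\<^esub> c \<oplus>\<^bsub>A\<^esub> d"
    if "y \<in> carrier A" "b \<in> carrier A" "c \<in> carrier A" "d \<in> carrier A" for y b c d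
  proof -
    have "(y \<oplus>\<^bsub>A\<^esub> b) \<oplus>\<^bsub>A\<^esub> c = (b \<oplus>\<^bsub>A\<^esub> c) \<oplus>\<^bsub>A\<^esub> y" using that by (simp add: M.a_ac)
    then show ?thesis using that by (simp add: M.a_assoc M.r_neg2)
  qed
  have "(der_commutator R (\<rho> u) (\<rho> v) f \<ominus> \<rho> (br u v) f) \<odot>\<^bsub>A\<^esub> w = k \<oplus>\<^bsub>A\<^esub> \<ominus>\<^bsub>A\<^esub> l \<oplus>\<^bsub>A\<^esub> \<ominus>\<^bsub>A\<^esub> m"
    by (simp add: der_commutator_def defs R.minus_eq smult_l_distr smult_l_minus closed)
  also have "\<dots> = (p \<oplus>\<^bsub>A\<^esub> \<ominus>\<^bsub>A\<^esub> p' \<oplus>\<^bsub>A\<^esub> \<ominus>\<^bsub>A\<^esub> p'') \<oplus>\<^bsub>A\<^esub> (k \<oplus>\<^bsub>A\<^esub> \<ominus>\<^bsub>A\<^esub> l \<oplus>\<^bsub>A\<^esub> \<ominus>\<^bsub>A\<^esub> m)"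
    by (simp add: 4 car)
  also have "\<dots> = (p \<oplus>\<^bsub>A\<^esub> k) \<oplus>\<^bsub>A\<^esub> \<ominus>\<^bsub>A\<^esub> (p' \<oplus>\<^bsub>A\<^esub> m) \<oplus>\<^bsub>A\<^esub> \<ominus>\<^bsub>A\<^esub> (p'' \<oplus>\<^bsub>A\<^esub> l)"
    using car by (simp add: M.minus_add M.a_ac)
  also have "\<dots> = ((q \<oplus>\<^bsub>A\<^esub> s) \<oplus>\<^bsub>A\<^esub> (p \<oplus>\<^bsub>A\<^esub> k)) \<oplus>\<^bsub>A\<^esub> \<ominus>\<^bsub>A\<^esub> (p' \<oplus>\<^bsub>A\<^esub> m) \<oplus>\<^bsub>A\<^esub>
      (\<ominus>\<^bsub>A\<^esub> (q \<oplus>\<^bsub>A\<^esub> s) \<oplus>\<^bsub>A\<^esub> \<ominus>\<^bsub>A\<^esub> (p'' \<oplus>\<^bsub>A\<^esub> l))"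
    by (rule cancel[symmetric]) (simp_all add: car)
  also have "\<dots> = ((p \<oplus>\<^bsub>A\<^esub> q) \<oplus>\<^bsub>A\<^esub> (s \<oplus>\<^bsub>A\<^esub> k)) \<oplus>\<^bsub>A\<^esub> \<ominus>\<^bsub>A\<^esub> (p' \<oplus>\<^bsub>A\<^esub> m) \<oplus>\<^bsub>A\<^esub>
      \<ominus>\<^bsub>A\<^esub> ((p'' \<oplus>\<^bsub>A\<^esub> s) \<oplus>\<^bsub>A\<^esub> (q \<oplus>\<^bsub>A\<^esub> l))"
    using car by (simp add: M.minus_add M.a_ac)
  also have "\<dots> = br u (br v (f \<odot>\<^bsub>A\<^esub> w)) \<oplus>\<^bsub>A\<^esub> br (f \<odot>\<^bsub>A\<^esub> w) (br u v) \<oplus>\<^bsub>A\<^esub> br v (br (f \<odot>\<^bsub>A\<^esub> w) u)"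
    by (simp only: 1 2 3)
  also have "\<dots> = \<zero>\<^bsub>A\<^esub>" using jacobi[OF u v, of "f \<odot>\<^bsub>A\<^esub> w"] f w by simp
  finally show ?thesis .
qed

text \<open>Linearity over K in the second argument is the Leibniz rule for scalars from K, whose
  anchor term vanishes by \<open>const\<close>; antisymmetry carries it to the first
  argument.\<close>

lemma lie_rinehart_algebraI:
  assumes K: "cring K" and \<iota>: "\<iota> \<in> ring_hom K R"
    and G: "generalized_lie_algebra R A br \<rho>"
    and const: "\<And>u a. u \<in> carrier A \<Longrightarrow> a \<in> carrier K \<Longrightarrow> \<rho> u (\<iota> a) = \<zero>\<^bsub>R\<^esub>"
    and bracket: "\<And>u v. u \<in> carrier A \<Longrightarrow> v \<in> carrier A \<Longrightarrow> \<rho> (br u v) = der_commutator R (\<rho> u) (\<rho> v)"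
  shows "lie_rinehart_algebra K \<iota> R A br \<rho>"
proof -
  have L: "lie_prealgebra R A br" using G by (simp add: generalized_lie_algebra_def)
  then have mod: "Module.module R A" by (simp add: lie_prealgebra_def)
  interpret Module.module R A by (rule mod)
  let ?A = "restrict_scalars \<iota> A"
  have sel: "carrier ?A = carrier A" "\<zero>\<^bsub>?A\<^esub> = \<zero>\<^bsub>A\<^esub>" "add ?A = add A"
    "a \<odot>\<^bsub>?A\<^esub> u = \<iota> a \<odot>\<^bsub>A\<^esub> u" for a u
    by (simp_all add: restrict_scalars_def)
  note hom = ring_hom_closed[OF \<iota>] ring_hom_mult[OF \<iota>] ring_hom_add[OF \<iota>] ring_hom_one[OF \<iota>]
  have br_closed: "br x y \<in> carrier A" if "x \<in> carrier A" "y \<in> carrier A" for x y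
    using L that by (auto simp: lie_prealgebra_def)
  note anti = lie_prealgebra_antisym[OF L]
  have leibniz: "br u (f \<odot>\<^bsub>A\<^esub> v) = (f \<odot>\<^bsub>A\<^esub> br u v) \<oplus>\<^bsub>A\<^esub> (\<rho> u f \<odot>\<^bsub>A\<^esub> v)"
    if "u \<in> carrier A" "v \<in> carrier A" "f \<in> carrier R" for u v f
    using G that by (simp add: generalized_lie_algebra_def)
  have "abelian_group ?A"
  proof (rule abelian_groupI)
    show "\<exists>y\<in>carrier ?A. y \<oplus>\<^bsub>?A\<^esub> x = \<zero>\<^bsub>?A\<^esub>" if "x \<in> carrier ?A" for x
      using that M.l_neg M.a_inv_closed unfolding sel by blast
  qed (simp_all add: sel M.a_ac)
  then have "Module.module K ?A"
    by (intro moduleI K) (simp_all add: sel hom smult_l_distr smult_r_distr smult_assoc1)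
  then have "lie_prealgebra K ?A br"
    using L unfolding lie_prealgebra_def sel by blast
  moreover have right: "br u (\<iota> a \<odot>\<^bsub>A\<^esub> v) = \<iota> a \<odot>\<^bsub>A\<^esub> br u v"
    if "a \<in> carrier K" "u \<in> carrier A" "v \<in> carrier A" for a u v
    using that by (simp add: leibniz hom const br_closed)
  moreover have "br (\<iota> a \<odot>\<^bsub>A\<^esub> u) v = \<iota> a \<odot>\<^bsub>A\<^esub> br u v"
    if "a \<in> carrier K" "u \<in> carrier A" "v \<in> carrier A" for a u v
    using that anti[of v "\<iota> a \<odot>\<^bsub>A\<^esub> u"] anti[of v u] right[of a v u]
    by (simp add: hom br_closed smult_r_minus)
  ultimately have "lie_algebra K ?A br" by (simp add: lie_algebra_def sel)
  then show ?thesis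
    using \<iota> G mod bracket by (simp add: lie_rinehart_algebra_def generalized_lie_algebra_def)
qed

text \<open>The anchor induced by a bundle map will be known to coincide with the given one on
  sections only, not on all functions of that type.\<close>

lemma generalized_lie_algebra_cong:
  assumes G: "generalized_lie_algebra R A br \<rho>" and eq: "\<And>u. u \<in> carrier A \<Longrightarrow> \<rho>' u = \<rho> u"
  shows "generalized_lie_algebra R A br \<rho>'"
proof -
  have "Module.module R A" using G by (simp add: generalized_lie_algebra_def lie_prealgebra_def)
  then interpret Module.module R A .
  have "\<rho>' (u \<oplus>\<^bsub>A\<^esub> v) = \<rho> (u \<oplus>\<^bsub>A\<^esub> v)" if "u \<in> carrier A" "v \<in> carrier A" for u v
    using that eq by simp
  moreover have "\<rho>' (f \<odot>\<^bsub>A\<^esub> u) = \<rho> (f \<odot>\<^bsub>A\<^esub> u)" if "f \<in> carrier R" "u \<in> carrier A" for f u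
    using that eq by simp
  ultimately show ?thesis
    using G eq by (auto simp: generalized_lie_algebra_def module_morphisms_def Pi_iff)
qed

section \<open>The Lie algebroid of a generalized Lie algebroid\<close>

text \<open>At one point the components of \<rho> become an anonymous matrix \<open>s\<close>. What
  is left shows the form of the dependence: the section enters through the coordinates of its value
  at x, the function through derivatives at one point of M.\<close>

lemma generalized_anchor_at_point:
  assumes "is_generalized_anchor F M \<rho> \<eta> h A" "x \<in> points (vbase F)"
  obtains fr s d e and k n :: nat where "d \<in> charts M" "inv_into (points M) h x \<in> fst d"
    "\<And>u f. u \<in> carrier (sections F) \<Longrightarrow> f \<in> carrier (smooth_functions (vbase F)) \<Longrightarrow>
      A u f x = (\<Sum>i<n. (\<Sum>\<alpha><k. frame_coord F fr (u x) \<alpha> * s \<alpha> i) *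
        chart_deriv d (e i) (f \<circ> h) (inv_into (points M) h x))"
proof -
  from bspec[OF assms(1)[unfolded is_generalized_anchor_def] assms(2)]
  show thesis
  proof (elim exE bexE conjE)
    fix k W t c d bs
    assume W: "x \<in> W" and d: "d \<in> charts M"
      and W_charts: "\<forall>y\<in>W. \<eta> y \<in> fst c \<and> inv_into (points M) h y \<in> fst d"
      and formula: "\<forall>u\<in>carrier (sections F). \<forall>f\<in>carrier (smooth_functions (vbase F)). \<forall>y\<in>W.
           A u f y =
             (\<Sum>\<alpha><k. \<Sum>i<length bs.
                frame_coord F (k, W, t) (u y) \<alpha> *
                frame_coord (tangent_bundle M) (coord_frame M bs c) (\<rho> (t \<alpha> y)) i *
                chart_deriv d (bs ! i) (f \<circ> h) (inv_into (points M) h y))"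
    show thesis
    proof (rule that)
      show "d \<in> charts M" "inv_into (points M) h x \<in> fst d" using d W W_charts by auto
      fix u f
      assume uf: "u \<in> carrier (sections F)" "f \<in> carrier (smooth_functions (vbase F))"
      have "A u f x = (\<Sum>\<alpha><k. \<Sum>i<length bs. frame_coord F (k, W, t) (u x) \<alpha> *
          frame_coord (tangent_bundle M) (coord_frame M bs c) (\<rho> (t \<alpha> x)) i *
          chart_deriv d (bs ! i) (f \<circ> h) (inv_into (points M) h x))"
        using bspec[OF bspec[OF bspec[OF formula uf(1)] uf(2)] W] .
      also have "\<dots> = (\<Sum>i<length bs. (\<Sum>\<alpha><k. frame_coord F (k, W, t) (u x) \<alpha> *
          frame_coord (tangent_bundle M) (coord_frame M bs c) (\<rho> (t \<alpha> x)) i) *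
          chart_deriv d (bs ! i) (f \<circ> h) (inv_into (points M) h x))"
        by (subst sum.swap) (simp add: sum_distrib_right)
      finally show "A u f x = (\<Sum>i<length bs. (\<Sum>\<alpha><k. frame_coord F (k, W, t) (u x) \<alpha> *
          frame_coord (tangent_bundle M) (coord_frame M bs c) (\<rho> (t \<alpha> x)) i) *
          chart_deriv d (bs ! i) (f \<circ> h) (inv_into (points M) h x))" .
    qed
  qed
qed

lemma generalized_anchor_pointwise:
  assumes "is_generalized_anchor F M \<rho> \<eta> h A" "x \<in> points (vbase F)"
    and "u \<in> carrier (sections F)" "u' \<in> carrier (sections F)" "u x = u' x"
    and "f \<in> carrier (smooth_functions (vbase F))"
  shows "A u f x = A u' f x"
  by (rule generalized_anchor_at_point[OF assms(1,2)]) (simp add: assms(3-6))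

lemma generalized_anchor_tangent:
  assumes A: "is_generalized_anchor F M \<rho> \<eta> h A" and x: "x \<in> points (vbase F)"
    and M: "smooth_manifold M" and N: "smooth_manifold (vbase F)"
    and h: "diffeomorphism M (vbase F) h"
    and u: "u \<in> carrier (sections F)"
  shows "(x, \<lambda>f\<in>carrier (smooth_functions (vbase F)). A u f x) \<in>
    carrier (fibre (tangent_bundle (vbase F)) x)"
proof (rule generalized_anchor_at_point[OF A x])
  fix fr s d e and k n :: nat
  let ?q = "inv_into (points M) h x"
  assume d: "d \<in> charts M" "?q \<in> fst d" and
    formula: "\<And>u f. u \<in> carrier (sections F) \<Longrightarrow> f \<in> carrier (smooth_functions (vbase F)) \<Longrightarrow>
      A u f x = (\<Sum>i<n. (\<Sum>\<alpha><k. frame_coord F fr (u x) \<alpha> * s \<alpha> i) * chart_deriv d (e i) (f \<circ> h) ?q)"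
  let ?r = "\<lambda>i. \<Sum>\<alpha><k. frame_coord F fr (u x) \<alpha> * s \<alpha> i"
  have q: "h ?q = x"
    using h x by (simp add: diffeomorphism_def bij_betw_def f_inv_into_f)
  have "smooth_map M (vbase F) h" using h by (simp add: diffeomorphism_def)
  from pushforward_tangent_fibre[OF M N this d, of ?r e "{..<n}"]
  have "(x, \<lambda>f\<in>carrier (smooth_functions (vbase F)). \<Sum>i<n. ?r i * chart_deriv d (e i) (f \<circ> h) ?q) \<in>
      carrier (fibre (tangent_bundle (vbase F)) x)"
    unfolding q .
  moreover have "(\<lambda>f\<in>carrier (smooth_functions (vbase F)). A u f x) =
      (\<lambda>f\<in>carrier (smooth_functions (vbase F)). \<Sum>i<n. ?r i * chart_deriv d (e i) (f \<circ> h) ?q)"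
    by (rule restrict_ext) (rule formula[OF u])
  ultimately show ?thesis by (simp only:)
qed

text \<open>The constant of the ring is \<open>undefined\<close> off N, so it is compared with the
  total constant function on the open set of all points. This supplies the vanishing on real scalars
  that additive derivations do not have by themselves.\<close>

lemma tangent_vector_const:
  assumes N: "smooth_manifold N" and x: "x \<in> points N" and X: "X \<in> carrier (fibre (tangent_bundle N) x)"
  shows "snd X (\<lambda>y\<in>points N. a) = 0"
proof -
  obtain c where c: "c \<in> charts N" "x \<in> fst c" using smooth_manifold_obtain_chart[OF N x] by blast
  obtain v where v: "X = tangent_vector N c v x" using X carrier_tangent_fibre[OF N c] by auto
  have "chart_deriv c v (\<lambda>_. a) x = chart_deriv c v (\<lambda>y\<in>points N. a) x"
    by (rule chart_deriv_cong[OF N c openin_topspace x]) (auto simp: o_def)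
  moreover have "chart_deriv c v (\<lambda>_. a) x = 0"
    by (simp add: chart_deriv_def o_def frechet_derivative_const)
  ultimately show ?thesis
    using smooth_functions_const[OF N, of a] by (simp add: v tangent_vector_def)
qed

lemma cring_real_ring: "cring real_ring"
proof (rule cringI)
  show "abelian_group real_ring"
  proof (rule abelian_groupI)
    show "\<exists>y\<in>carrier real_ring. y \<oplus>\<^bsub>real_ring\<^esub> x = \<zero>\<^bsub>real_ring\<^esub>" for x
      by (auto simp: real_ring_def intro: exI[of _ "- x"])
  qed (auto simp: real_ring_def)
  show "Group.comm_monoid real_ring"
    by (rule comm_monoidI) (auto simp: real_ring_def)
qed (auto simp: real_ring_def algebra_simps)

text \<open>Subtraction in the ring is defined through additive inverses and not pointwise; its
  values are found from f = (f - g) + g, where the sum is pointwise.\<close>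

lemma smooth_functions_minus:
  assumes "cring (smooth_functions N)" "f \<in> carrier (smooth_functions N)" "g \<in> carrier (smooth_functions N)"
    and x: "x \<in> points N"
  shows "(f \<ominus>\<^bsub>smooth_functions N\<^esub> g) x = f x - g x"
proof -
  interpret cring "smooth_functions N" by fact
  have "f = (f \<ominus>\<^bsub>smooth_functions N\<^esub> g) \<oplus>\<^bsub>smooth_functions N\<^esub> g"
    using assms(2,3) by (simp add: minus_eq a_assoc l_neg)
  then have "f x = (f \<ominus>\<^bsub>smooth_functions N\<^esub> g) x + g x"
    using x by (metis (no_types, lifting) smooth_functions_def partial_object.select_convs
        ring.simps(2) restrict_apply')
  then show ?thesis by simp
qed

theorem proposition3p11:
  fixes F :: "('f, 'n, 'd::real_inner) vbundle"
    and M :: "('m, 'e::real_inner) manifold"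
    and br :: "('n \<Rightarrow> 'f) \<Rightarrow> ('n \<Rightarrow> 'f) \<Rightarrow> ('n \<Rightarrow> 'f)"
    and \<rho> :: "'f \<Rightarrow> 'm tvec"
    and \<eta> :: "'n \<Rightarrow> 'm" and h :: "'m \<Rightarrow> 'n"
    and A :: "('n \<Rightarrow> 'f) \<Rightarrow> ('n \<Rightarrow> real) \<Rightarrow> 'n \<Rightarrow> real"
  assumes "generalized_lie_algebroid F M br \<rho> \<eta> h A"
  shows "\<exists>\<theta> :: 'f \<Rightarrow> 'n tvec.
           lie_algebroid F br \<theta> \<and>
           (\<forall>u\<in>carrier (sections F). lie_algebroid_anchor F \<theta> u = A u)"
proof -
  let ?N = "vbase F" and ?R = "smooth_functions (vbase F)" and ?G = "sections F"
  let ?TN = "tangent_bundle (vbase F)"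
  have F: "vector_bundle F" and M: "smooth_manifold M" and h: "diffeomorphism M ?N h"
    and anchor: "is_generalized_anchor F M \<rho> \<eta> h A" and gla: "generalized_lie_algebra ?R ?G br A"
    using assms by (auto simp: generalized_lie_algebroid_def)
  have N: "smooth_manifold ?N" using F by (simp add: vector_bundle_def)
  have A_mor: "A \<in> module_morphisms ?R ?G (Der ?R)" and L: "lie_prealgebra ?R ?G br"
    using gla by (auto simp: generalized_lie_algebra_def)
  have mod: "Module.module ?R ?G" using L by (simp add: lie_prealgebra_def)
  interpret Module.module ?R ?G by (rule mod)
  have sec_mem: "u x \<in> carrier (fibre F x)" if "u \<in> carrier ?G" "x \<in> points ?N" for u x
    using that by (simp add: sections_def smooth_local_section_def)
  have sec_add: "(u \<oplus>\<^bsub>?G\<^esub> v) x = u x \<oplus>\<^bsub>fibre F x\<^esub> v x" if "x \<in> points ?N" for u v x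
    using that by (simp add: sections_def fibre_def)
  have sec_smult: "(f \<odot>\<^bsub>?G\<^esub> u) x = f x \<odot>\<^bsub>fibre F x\<^esub> u x" if "x \<in> points ?N" for f u x
    using that by (simp add: sections_def fibre_def)
  have sec_zero: "\<zero>\<^bsub>?G\<^esub> x = \<zero>\<^bsub>fibre F x\<^esub>" if "x \<in> points ?N" for x
    using that by (simp add: sections_def fibre_def)
  have A_add: "A (u \<oplus>\<^bsub>?G\<^esub> v) f x = A u f x + A v f x"
    if "u \<in> carrier ?G" "v \<in> carrier ?G" "f \<in> carrier ?R" "x \<in> points ?N" for u v f x
  proof -
    have "A (u \<oplus>\<^bsub>?G\<^esub> v) f = A u f \<oplus>\<^bsub>?R\<^esub> A v f"
      using A_mor that by (simp add: module_morphisms_def Der_def)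
    then show ?thesis using that(4) by (simp add: smooth_functions_def)
  qed
  have A_smult: "A (g \<odot>\<^bsub>?G\<^esub> u) f x = g x * A u f x"
    if "u \<in> carrier ?G" "g \<in> carrier ?R" "f \<in> carrier ?R" "x \<in> points ?N" for u g f x
  proof -
    have "A (g \<odot>\<^bsub>?G\<^esub> u) f = g \<otimes>\<^bsub>?R\<^esub> A u f"
      using A_mor that by (simp add: module_morphisms_def Der_def)
    then show ?thesis using that(4) by (simp add: smooth_functions_def)
  qed
  note A_closed = module_derivation_closed[OF A_mor]
  note A_pointwise = generalized_anchor_pointwise[OF anchor]
  have R_ext: "f = g" if "f \<in> carrier ?R" "g \<in> carrier ?R" "\<And>x. x \<in> points ?N \<Longrightarrow> f x = g x" for f g
    using that by (auto simp: smooth_functions_def intro: extensionalityI)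

  \<comment> \<open>The bundle map \<theta>: construction, fibrewise linearity and
    smoothness\<close>
  define U where "U v = (SOME u. u \<in> carrier ?G \<and> u (vproj F v) = v)" for v
  \<comment> \<open>The section chosen by \<open>U\<close> is arbitrary; the next step shows that
    any section with the same value gives the same vector.\<close>
  define \<theta> where "\<theta> v = (vproj F v, \<lambda>f\<in>carrier ?R. A (U v) f (vproj F v))" for v
  have \<theta>_section: "\<theta> (u x) = (x, \<lambda>f\<in>carrier ?R. A u f x)"
    if u: "u \<in> carrier ?G" and x: "x \<in> points ?N" for u x
  proof -
    have proj: "vproj F (u x) = x" using sec_mem[OF u x] by (simp add: fibre_def)
    have "U (u x) \<in> carrier ?G \<and> U (u x) (vproj F (u x)) = u x"
      unfolding U_def by (rule someI[of _ u]) (simp add: u proj)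
    then have "A (U (u x)) f x = A u f x" if "f \<in> carrier ?R" for f
      using A_pointwise[OF x _ u _ that] proj by simp
    then show ?thesis by (auto simp: \<theta>_def proj intro!: restrict_ext)
  qed
  have tangent: "(x, \<lambda>f\<in>carrier ?R. A u f x) \<in> carrier (fibre ?TN x)"
    if "u \<in> carrier ?G" "x \<in> points ?N" for u x
    by (rule generalized_anchor_tangent[OF anchor that(2) M N h that(1)])
  note through = section_through_vector[OF F mod]

  have \<theta>_fibre: "\<theta> v \<in> carrier (fibre ?TN x)" if x: "x \<in> points ?N" and v: "v \<in> carrier (fibre F x)" for v x
    using through[OF x v] \<theta>_section tangent x by metis
  have \<theta>_add: "\<theta> (v \<oplus>\<^bsub>fibre F x\<^esub> w) = \<theta> v \<oplus>\<^bsub>fibre ?TN x\<^esub> \<theta> w"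
    if x: "x \<in> points ?N" and v: "v \<in> carrier (fibre F x)" and w: "w \<in> carrier (fibre F x)" for v w x
  proof -
    obtain u where u: "u \<in> carrier ?G" "u x = v" using through[OF x v] .
    obtain u' where u': "u' \<in> carrier ?G" "u' x = w" using through[OF x w] .
    have "\<theta> (v \<oplus>\<^bsub>fibre F x\<^esub> w) = (x, \<lambda>f\<in>carrier ?R. A (u \<oplus>\<^bsub>?G\<^esub> u') f x)"
      using \<theta>_section[of "u \<oplus>\<^bsub>?G\<^esub> u'" x] u u' x by (simp add: sec_add)
    then show ?thesis
      using \<theta>_section[OF u(1) x] \<theta>_section[OF u'(1) x] u u' x
      by (auto simp: A_add fibre_def tangent_bundle_def intro!: restrict_ext)
  qed
  have \<theta>_smult: "\<theta> (a \<odot>\<^bsub>fibre F x\<^esub> v) = a \<odot>\<^bsub>fibre ?TN x\<^esub> \<theta> v"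
    if x: "x \<in> points ?N" and v: "v \<in> carrier (fibre F x)" for a v x
  proof -
    obtain u where u: "u \<in> carrier ?G" "u x = v" using through[OF x v] .
    let ?c = "\<lambda>y\<in>points ?N. a"
    note c = smooth_functions_const[OF N, of a]
    have "\<theta> (a \<odot>\<^bsub>fibre F x\<^esub> v) = (x, \<lambda>f\<in>carrier ?R. A (?c \<odot>\<^bsub>?G\<^esub> u) f x)"
      using \<theta>_section[of "?c \<odot>\<^bsub>?G\<^esub> u" x] u x c by (simp add: sec_smult)
    then show ?thesis
      using \<theta>_section[OF u(1) x] u x c
      by (auto simp: A_smult fibre_def tangent_bundle_def intro!: restrict_ext)
  qed
  \<comment> \<open>In this step \<open>U\<close> denotes the domain of a frame and hides the choice
    function of the same name.\<close>
  have \<theta>_smooth: "smooth_fun_on ?N (U \<inter> id -` V) (\<lambda>x. frame_coord ?TN (l, V, s) (\<theta> (t \<alpha> x)) i)"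
    if fr: "(k, U, t) \<in> vframes F" and fr': "(l, V, s) \<in> vframes ?TN" and \<alpha>: "\<alpha> < k" and i: "i < l"
    for k U t l V s \<alpha> i
  proof (rule smooth_fun_on_local[OF N])
    fix x assume "x \<in> U \<inter> id -` V"
    then have xU: "x \<in> U" and xV: "x \<in> V" by auto
    obtain bs c where bs: "orthonormal_list bs" and c: "c \<in> charts ?N"
      and eq: "(l, V, s) = coord_frame ?N bs c"
      using fr' by (auto simp: tangent_bundle_def)
    have lV: "l = length bs" "V = fst c" using eq by (auto simp: coord_frame_def)
    obtain u W where u: "u \<in> carrier ?G" and W: "openin (mtop ?N) W" "x \<in> W" "W \<subseteq> U"
      and ut: "\<And>y. y \<in> W \<Longrightarrow> u y = t \<alpha> y"
      using frame_section_extend[OF F fr \<alpha> xU] by blast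
    obtain f W' where f: "f \<in> carrier ?R" and W': "openin (mtop ?N) W'" "x \<in> W'" "W' \<subseteq> V"
      and fc: "\<And>y. y \<in> W' \<Longrightarrow> f y = snd c y \<bullet> bs ! i"
      using smooth_functions_coordinate[OF N c xV[unfolded lV(2)], of "bs ! i"] lV(2) by blast
    have "A u f y = frame_coord ?TN (l, V, s) (\<theta> (t \<alpha> y)) i" if y: "y \<in> W \<inter> W'" for y
    proof -
      have yN: "y \<in> points ?N" using y W(1) openin_subset by blast
      have "frame_coord ?TN (l, V, s) (\<theta> (u y)) i = snd (\<theta> (u y)) f"
        unfolding eq using y W'(3) i lV \<theta>_fibre[OF yN sec_mem[OF u yN]]
        by (intro frame_coord_tangent_eq_action[OF N c _ bs _ _ f W'(1) _ fc]) auto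
      then show ?thesis using \<theta>_section[OF u yN] f ut y by simp
    qed
    moreover have "openin (mtop ?N) (W \<inter> W')" using W W' by blast
    moreover have "smooth_fun_on ?N (W \<inter> W') (A u f)"
    proof (rule smooth_fun_on_subset)
      show "W \<inter> W' \<subseteq> points ?N" using W(1) openin_subset by blast
      show "smooth_fun_on ?N (points ?N) (A u f)"
        using A_closed[OF u f] by (simp add: smooth_functions_def)
    qed
    ultimately show "\<exists>W g. openin (mtop ?N) W \<and> x \<in> W \<and> smooth_fun_on ?N W g \<and>
        (\<forall>y\<in>W. g y = frame_coord ?TN (l, V, s) (\<theta> (t \<alpha> y)) i)"
      using W(2) W'(2) by blast
  qed
  have morphism: "vb_morphism F ?TN \<theta> id"
    using smooth_map_id[OF N] \<theta>_fibre \<theta>_add \<theta>_smult \<theta>_smooth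
    by (auto simp: vb_morphism_def)

  \<comment> \<open>Agreement of the induced anchor with \<open>A\<close>\<close>
  have anchor_eq: "lie_algebroid_anchor F \<theta> u = A u" if u: "u \<in> carrier ?G" for u
  proof -
    have "A u \<in> carrier ?R \<rightarrow>\<^sub>E carrier ?R"
      using A_mor u by (auto simp: module_morphisms_def Der_def)
    moreover have "inv_into (points ?N) id x = x" if "x \<in> points ?N" for x
      using inv_into_f_f[of id "points ?N" x] that by simp
    then have "vf_action ?N (section_map F ?TN \<theta> id u) f = (\<lambda>x\<in>points ?N. A u f x)"
      if "f \<in> carrier ?R" for f
      using that \<theta>_section[OF u]
      by (auto simp: vf_action_def section_map_def intro!: restrict_ext)
    moreover have "(\<lambda>x\<in>points ?N. A u f x) = A u f" if "f \<in> carrier ?R" for f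
      using A_closed[OF u that] by (auto simp: smooth_functions_def intro: extensional_restrict)
    \<comment> \<open>The equation is between total functions, so it also needs that both sides are
      \<open>undefined\<close> off the carrier of the ring.\<close>
    ultimately show ?thesis
      unfolding lie_algebroid_anchor_def
      by (intro extensionalityI[of _ "carrier ?R"]) (auto simp: vf_action_def PiE_def)
  qed

  \<comment> \<open>Preservation of brackets\<close>
  have bracket: "A (br u v) = der_commutator ?R (A u) (A v)"
    if u: "u \<in> carrier ?G" and v: "v \<in> carrier ?G" for u v
  proof -
    have uv: "br u v \<in> carrier ?G" using L u v by (auto simp: lie_prealgebra_def)
    have "A (br u v) f = der_commutator ?R (A u) (A v) f" if f: "f \<in> carrier ?R" for f
    proof (rule R_ext)
      let ?D = "der_commutator ?R (A u) (A v) f"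
      have D: "?D = A u (A v f) \<ominus>\<^bsub>?R\<^esub> A v (A u f)" using f by (simp add: der_commutator_def)
      show D_closed: "?D \<in> carrier ?R" unfolding D using A_closed u v f by simp
      show B_closed: "A (br u v) f \<in> carrier ?R" using A_closed uv f by simp
      fix x assume x: "x \<in> points ?N"
      interpret Fx: Module.module real_ring "fibre F x" by (rule vector_bundle_fibre_module[OF F x])
      show "A (br u v) f x = ?D x"
      proof (cases "\<exists>w\<in>carrier ?G. w x \<noteq> \<zero>\<^bsub>fibre F x\<^esub>")
        case True
        then obtain w where w: "w \<in> carrier ?G" "w x \<noteq> \<zero>\<^bsub>fibre F x\<^esub>" by blast
        let ?g = "?D x - A (br u v) f x"
        have "((?D \<ominus>\<^bsub>?R\<^esub> A (br u v) f) \<odot>\<^bsub>?G\<^esub> w) x = \<zero>\<^bsub>fibre F x\<^esub>"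
          using generalized_lie_algebra_curvature_annihilates[OF gla u v w(1) f] sec_zero[OF x] by simp
        then have g0: "?g \<odot>\<^bsub>fibre F x\<^esub> w x = \<zero>\<^bsub>fibre F x\<^esub>"
          by (simp add: sec_smult[OF x] smooth_functions_minus[OF R.is_cring D_closed B_closed x])
        have "?g = 0"
        proof (rule ccontr)
          assume "?g \<noteq> 0"
          have "w x = inverse ?g \<odot>\<^bsub>fibre F x\<^esub> (?g \<odot>\<^bsub>fibre F x\<^esub> w x)"
            using Fx.smult_assoc1[of "inverse ?g" ?g "w x"] Fx.smult_one sec_mem[OF w(1) x] \<open>?g \<noteq> 0\<close>
            by (simp add: real_ring_def)
          also have "\<dots> = \<zero>\<^bsub>fibre F x\<^esub>"
            unfolding g0 by (rule Fx.smult_r_null) (simp add: real_ring_def)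
          finally show False using w(2) by simp
        qed
        then show ?thesis by simp
      next
        case False
        have vanish: "A w g x = 0" if w: "w \<in> carrier ?G" and g: "g \<in> carrier ?R" for w g
        proof -
          \<comment> \<open>Both values are the zero vector, so the pointwise dependence of
            \<open>A\<close> together with additivity gives twice \<open>A w g x\<close> equal to
            \<open>A w g x\<close>.\<close>
          have "(w \<oplus>\<^bsub>?G\<^esub> w) x = w x" using False w M.add.m_closed by metis
          then have "A (w \<oplus>\<^bsub>?G\<^esub> w) g x = A w g x"
            by (intro A_pointwise[OF x]) (use w g in auto)
          then show ?thesis using A_add[OF w w g x] by simp
        qed
        have "?D x = A u (A v f) x - A v (A u f) x"
          unfolding D by (rule smooth_functions_minus[OF R.is_cring _ _ x]) (use A_closed u v f in auto)
        then show ?thesis using vanish A_closed u v uv f by simp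
      qed
    qed
    moreover have "A (br u v) \<in> extensional (carrier ?R)"
      using A_mor uv by (auto simp: module_morphisms_def Der_def PiE_def)
    moreover have "der_commutator ?R (A u) (A v) \<in> extensional (carrier ?R)"
      by (simp add: der_commutator_def)
    ultimately show ?thesis by (auto intro: extensionalityI)
  qed

  \<comment> \<open>Real scalars and the Lie-Rinehart structure\<close>
  have const: "A u (\<lambda>x\<in>points ?N. a) = \<zero>\<^bsub>?R\<^esub>" if u: "u \<in> carrier ?G" for u a
  proof (rule R_ext[OF A_closed[OF u smooth_functions_const[OF N]] R.zero_closed])
    fix x assume x: "x \<in> points ?N"
    show "A u (\<lambda>x\<in>points ?N. a) x = \<zero>\<^bsub>?R\<^esub> x"
      using tangent_vector_const[OF N x tangent[OF u x], of a] smooth_functions_const[OF N, of a] x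
      by (simp add: smooth_functions_def)
  qed
  have \<iota>: "(\<lambda>a. \<lambda>x\<in>points ?N. a) \<in> ring_hom real_ring ?R"
  proof (rule ring_hom_memI)
    show "(\<lambda>x\<in>points ?N. a) \<in> carrier ?R" for a by (rule smooth_functions_const[OF N])
  qed (auto simp: real_ring_def smooth_functions_def intro!: restrict_ext)
  have "lie_rinehart_algebra real_ring (\<lambda>a. \<lambda>x\<in>points ?N. a) ?R ?G br (lie_algebroid_anchor F \<theta>)"
  proof (rule lie_rinehart_algebraI[OF cring_real_ring \<iota> generalized_lie_algebra_cong[OF gla anchor_eq]])
    show "lie_algebroid_anchor F \<theta> u (\<lambda>x\<in>points ?N. a) = \<zero>\<^bsub>?R\<^esub>" if "u \<in> carrier ?G" for u a
      using anchor_eq const that by simp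
    show "lie_algebroid_anchor F \<theta> (br u v) =
        der_commutator ?R (lie_algebroid_anchor F \<theta> u) (lie_algebroid_anchor F \<theta> v)"
      if "u \<in> carrier ?G" "v \<in> carrier ?G" for u v
    proof -
      have "br u v \<in> carrier ?G" using L that by (auto simp: lie_prealgebra_def)
      then show ?thesis using anchor_eq bracket that by simp
    qed
  qed
  then have "lie_algebroid F br \<theta>" using F morphism by (simp add: lie_algebroid_def)
  then show ?thesis using anchor_eq by blast
qed

end
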